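(* Let $\boldsymbol\omega\in SS_b(2k)$ be a special symmetric word with $b$ distinct letters which appear $2k_1,2k_2,\dots,2k_b$ times respectively (letters numbered in order of first appearance). Then there is a coloured rooted tree corresponding to $\boldsymbol\omega$ with $k+1$ vertices and $b+1$ distinct colours $a_0,a_1,\dots,a_b$ such that: (a) the root is of colour $a_0$ and there are exactly $k_i$ vertices of colour $a_i$ for $1\le i\le b$; (b) if two vertices are of the same colour then their parents are also of the same colour; (c) vertices with the same colour are at the same distance from the root. Moreover, for every such tree with $k+1$ vertices and $b+1$ distinct colours there is a unique word belonging to $SS_b(2k)$, and vice versa (i.e. the words in $SS_b(2k)$ with letter multiplicities $2k_1,\dots,2k_b$ are in one-to-one correspondence with the coloured rooted trees satisfying (a), (b), (c)). In particular, the Catalan number $\frac1{k+1}\binom{2k}{k}$ counts the coloured rooted trees with $k+1$ vertices, each vertex having a distinct colour.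
   Context: Coloured rooted trees here are rooted plane trees (children of each vertex ordered left to right) with coloured vertices; the root is the only vertex of colour $a_0$, and colours $a_0,a_1,\dots,a_b$ are numbered in order of first appearance when the tree is explored depth first, left to right. "Distance from the root" is graph distance. A partition of $\{1,\dots,2k\}$ is identified with a word of length $2k$: positions in the same block carry the same letter, and letters are introduced in alphabetical order. Special symmetric partitions/words $SS(2k)$. Order blocks by smallest elements, $V_1<\dots<V_r$. The one-block partition of $\{1,\dots,2k\}$ belongs to $SS(2k)$ for each $k\ge1$, and it is the only element of $SS(2)$. For $k>1$, $\sigma=\{V_1<\dots<V_r\}$ belongs to $SS(2k)$ if and only if: (1) $V_r$ is a union of even-sized intervals of consecutive integers $I_1\cup\dots\cup I_l$ (listed increasingly); (2) for $1\le i\le r-1$, $1\le j\le l-1$, the number of elements of $V_i$ in $[\min I_j,\max I_{j+1}]\setminus(I_j\cup I_{j+1})$ is even; (3) $\sigma\setminus\{V_r\}$ (if nonempty), as a partition of $\{1,\dots,2k\}\setminus V_r$ relabelled order-preservingly, is special symmetric. $SS_b(2k)$ denotes those with exactly $b$ blocks (distinct letters). *)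

theory Defs
  imports Complex_Main "HOL-Library.Disjoint_Sets"
begin

section \<open>Special symmetric partitions and words\<close>

definition increasing_even_intervals :: "nat set list \<Rightarrow> bool" where
  "increasing_even_intervals Is \<longleftrightarrow>
     (\<forall>I\<in>set Is. \<exists>a n. 0 < n \<and> I = {a..<a + 2 * n}) \<and>
     sorted_wrt (\<lambda>I J. Max I < Min J) Is"

text \<open>
  The order-preserving bijection from a finite set \<open>S\<close> of naturals onto \<open>{1..card S}\<close>,
  applied blockwise to a partition of \<open>S\<close>.
\<close>

definition relabel :: "nat set \<Rightarrow> nat set set \<Rightarrow> nat set set" where
  "relabel S \<sigma> = (\<lambda>W. (\<lambda>x. card {y \<in> S. y \<le> x}) ` W) ` \<sigma>"

text \<open>
  \<open>special_symmetric k \<sigma>\<close> means \<open>\<sigma> \<in> SS(2k)\<close>. In the second rule \<open>V\<close> is the last block in the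
  order by smallest elements, and list indices start at 0.
\<close>

inductive special_symmetric :: "nat \<Rightarrow> nat set set \<Rightarrow> bool" where
  one_block: "1 \<le> k \<Longrightarrow> special_symmetric k {{1..2 * k}}"
| last_block:
    "\<lbrakk> 1 < k; partition_on {1..2 * k} \<sigma>;
       V \<in> \<sigma>; \<forall>W\<in>\<sigma>. Min W \<le> Min V;
       increasing_even_intervals Is; V = \<Union>(set Is);
       \<forall>W\<in>\<sigma> - {V}. \<forall>j. Suc j < length Is \<longrightarrow>
         even (card (W \<inter> ({Min (Is ! j)..Max (Is ! Suc j)} - (Is ! j \<union> Is ! Suc j))));
       \<sigma> - {V} = {} \<or>
         special_symmetric (k - card V div 2) (relabel ({1..2 * k} - V) (\<sigma> - {V})) \<rbrakk>
     \<Longrightarrow> special_symmetric k \<sigma>"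

definition order_of_appearance :: "'a list \<Rightarrow> 'a list" where
  "order_of_appearance xs = rev (remdups (rev xs))"

text \<open>The letters of a word are \<open>1, 2, \<dots>\<close>; positions are numbered from 1 as in \<open>{1..2k}\<close>.\<close>

definition word_partition :: "nat list \<Rightarrow> nat set set" where
  "word_partition w = (\<lambda>c. {p \<in> {1..length w}. w ! (p - 1) = c}) ` set w"

definition SS_words :: "nat \<Rightarrow> nat \<Rightarrow> nat list set" where
  "SS_words b k =
     {w. length w = 2 * k \<and> card (set w) = b \<and>
         order_of_appearance w = [1..<Suc (card (set w))] \<and>
         special_symmetric k (word_partition w)}"

section \<open>Coloured rooted plane trees\<close>

datatype 'c ptree = Node (root_colour: 'c) (subtrees: "'c ptree list")

text \<open>
  Vertices are addressed by the list of child indices leading to them from the root, so the root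
  is \<open>[]\<close> and the parent of a non-root vertex \<open>v\<close> is \<open>butlast v\<close>.
\<close>

fun subtree_at :: "'c ptree \<Rightarrow> nat list \<Rightarrow> 'c ptree option" where
  "subtree_at t [] = Some t"
| "subtree_at t (i # p) =
     (if i < length (subtrees t) then subtree_at (subtrees t ! i) p else None)"

definition vertices :: "'c ptree \<Rightarrow> nat list set" where
  "vertices t = {v. subtree_at t v \<noteq> None}"

definition colour_at :: "'c ptree \<Rightarrow> nat list \<Rightarrow> 'c" where
  "colour_at t v = root_colour (the (subtree_at t v))"

definition parent :: "nat list \<Rightarrow> nat list" where
  "parent v = butlast v"

definition adjacency :: "'c ptree \<Rightarrow> (nat list \<times> nat list) set" where
  "adjacency t = {(u, v). u \<in> vertices t \<and> v \<in> vertices t \<and>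
     (v \<noteq> [] \<and> u = parent v \<or> u \<noteq> [] \<and> v = parent u)}"

definition graph_dist :: "'c ptree \<Rightarrow> nat list \<Rightarrow> nat list \<Rightarrow> nat" where
  "graph_dist t u v = (LEAST n. (u, v) \<in> adjacency t ^^ n)"

fun preorder :: "'c ptree \<Rightarrow> 'c list" where
  "preorder (Node c ts) = c # concat (map preorder ts)"

text \<open>The colour \<open>a\<^sub>i\<close> is represented by the number \<open>i\<close>.\<close>

definition coloured_tree :: "nat ptree \<Rightarrow> bool" where
  "coloured_tree t \<longleftrightarrow>
     order_of_appearance (preorder t) = [0..<card (colour_at t ` vertices t)] \<and>
     (\<forall>v\<in>vertices t. colour_at t v = 0 \<longleftrightarrow> v = [])"

definition coloured_trees :: "nat \<Rightarrow> nat \<Rightarrow> nat ptree set" where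
  "coloured_trees b k =
     {t. coloured_tree t \<and> card (vertices t) = k + 1 \<and> card (colour_at t ` vertices t) = b + 1}"

definition colour_multiplicities :: "nat \<Rightarrow> (nat \<Rightarrow> nat) \<Rightarrow> nat ptree \<Rightarrow> bool" where
  "colour_multiplicities b m t \<longleftrightarrow>
     colour_at t [] = 0 \<and> (\<forall>i\<in>{1..b}. card {v \<in> vertices t. colour_at t v = i} = m i)"

definition same_colour_parents :: "nat ptree \<Rightarrow> bool" where
  "same_colour_parents t \<longleftrightarrow>
     (\<forall>u\<in>vertices t - {[]}. \<forall>v\<in>vertices t - {[]}.
        colour_at t u = colour_at t v \<longrightarrow> colour_at t (parent u) = colour_at t (parent v))"

definition same_colour_dist :: "nat ptree \<Rightarrow> bool" where
  "same_colour_dist t \<longleftrightarrow>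
     (\<forall>u\<in>vertices t. \<forall>v\<in>vertices t.
        colour_at t u = colour_at t v \<longrightarrow> graph_dist t [] u = graph_dist t [] v)"

text \<open>
  The word corresponding to a tree: walk around the tree depth first, left to right, so that every
  edge is traversed once downwards and once upwards, and at each traversal write down the colour of
  the endpoint of the edge farther from the root (letter \<open>i\<close> for colour \<open>a\<^sub>i\<close>).
\<close>

fun contour_word :: "'c ptree \<Rightarrow> 'c list" where
  "contour_word (Node c ts) =
     concat (map (\<lambda>s. root_colour s # contour_word s @ [root_colour s]) ts)"

end

theory Submission
  imports Defs "HOL-Computational_Algebra.Formal_Power_Series"
begin

text \<open>
  Read a word with a stack that pops when the next letter equals the top and pushes it otherwise,
  starting from a bottom letter that does not occur in the word. Contour words of trees in which
  adjacent vertices have different colours are exactly the words that lead back to the initial stack,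
  and the stacks on the way are the colour sequences of the paths from the vertices up to the root.
  Conditions (b) and (c) say that a stack is determined by its top.

  Under this condition the letters in a stack are distinct and are those that have occurred an odd
  number of times, so two stacks with the same parities coincide. Hence inserting a new last block,
  made of pairs \<open>zz\<close> at places that agree in all parities, hangs leaves of colour \<open>z\<close> on vertices
  of one colour; conversely, vertices of the last colour are leaves, and deleting them removes the
  last block. Induction on the number of blocks identifies special symmetric words with contour words.
\<close>

section \<open>Words as walks on stacks\<close>

text \<open>Popping equal neighbours is cancellation under \<open>x x = 1\<close>: above its bottom
  letter, a stack is the reversed reduced form of the prefix in the free product of groups of order
  two, one for each letter. Condition (2) of special symmetry sees only parities, that is, the image
  in the abelianised group, where the order of the letters in a stack is lost. This gap is the
  obstacle. The requirement that a stack be determined by its top closes it, and is therefore part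
  of \<open>tree_word\<close>, to be carried through the induction. The induction runs on words
  rather than on trees or partitions: taking out a block is then a \<open>filter\<close>, and the
  relabelling in condition (3) is the renumbering of positions that the deletion brings
  about.\<close>

definition step :: "'a list \<Rightarrow> 'a \<Rightarrow> 'a list" where
  "step s c = (if hd s = c then tl s else c # s)"

lemma step_Cons [simp]: "step (h # s) x = (if h = x then s else x # h # s)"
  by (simp add: step_def)

lemma step_push: "hd s \<noteq> x \<Longrightarrow> step s x = x # s"
  by (simp add: step_def)

abbreviation run :: "'a list \<Rightarrow> 'a list \<Rightarrow> 'a list" where
  "run \<equiv> foldl step"

definition visited :: "'a list \<Rightarrow> 'a list \<Rightarrow> 'a list set" where
  "visited s w = {run s p | p q. w = p @ q}"

definition tree_word :: "'a \<Rightarrow> 'a list \<Rightarrow> bool" where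
  "tree_word r w \<longleftrightarrow> r \<notin> set w \<and> run [r] w = [r] \<and>
     (\<forall>s\<in>visited [r] w. \<forall>s'\<in>visited [r] w. hd s = hd s' \<longrightarrow> s = s')"

lemma visitedI: "w = p @ q \<Longrightarrow> run s p \<in> visited s w"
  by (auto simp: visited_def)

lemma tree_word_Nil: "tree_word r []"
  by (auto simp: tree_word_def visited_def)

lemma visited_append: "visited s (u @ v) = visited s u \<union> visited (run s u) v"
proof (intro equalityI subsetI)
  fix x assume "x \<in> visited s (u @ v)"
  then obtain p q where x: "x = run s p" and "u @ v = p @ q"
    by (auto simp: visited_def)
  then obtain us where "u = p @ us \<or> (p = u @ us \<and> v = us @ q)"
    by (auto simp: append_eq_append_conv2)
  with x show "x \<in> visited s u \<union> visited (run s u) v"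
    by (force simp: visited_def)
next
  fix x assume "x \<in> visited s u \<union> visited (run s u) v"
  then show "x \<in> visited s (u @ v)"
  proof
    assume "x \<in> visited s u"
    then show ?thesis by (force simp: visited_def)
  next
    assume "x \<in> visited (run s u) v"
    then obtain p q where "x = run (run s u) p" "v = p @ q" by (auto simp: visited_def)
    then have "x = run s (u @ p)" "u @ v = (u @ p) @ q" by auto
    then show ?thesis unfolding visited_def by blast
  qed
qed

lemma visited_Nil [simp]: "visited s [] = {s}"
  by (auto simp: visited_def)

lemma visited_Cons: "visited s (c # w) = insert s (visited (step s c) w)"
proof -
  have "visited s [c] = {s, step s c}"
  proof (intro equalityI subsetI)
    fix x assume "x \<in> visited s [c]"
    then obtain p q where "x = run s p" "[c] = p @ q" by (auto simp: visited_def)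
    then show "x \<in> {s, step s c}" by (cases p) auto
  next
    fix x assume "x \<in> {s, step s c}"
    then show "x \<in> visited s [c]"
      using visitedI[of "[c]" "[]" "[c]" s] visitedI[of "[c]" "[c]" "[]" s] by auto
  qed
  moreover have "step s c \<in> visited (step s c) w"
    using visitedI[of w "[]" w "step s c"] by simp
  ultimately show ?thesis
    using visited_append[of s "[c]" w] by auto
qed

text \<open>Only reading \<open>r\<close> could pop \<open>r\<close>. So it stays at the bottom, and
  the \<open>hd\<close> in \<open>step\<close> is always taken of a nonempty stack.\<close>

lemma run_bottom:
  assumes "r \<notin> set p"
  obtains s where "run [r] p = s @ [r]" "set s \<subseteq> set p"
proof -
  have "\<exists>s. run [r] p = s @ [r] \<and> set s \<subseteq> set p"
    using assms
  proof (induction p rule: rev_induct)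
    case (snoc x p)
    then obtain s where s: "run [r] p = s @ [r]" "set s \<subseteq> set p" by auto
    show ?case
    proof (cases "hd (run [r] p) = x")
      case True
      then obtain s' where "s = x # s'" using s snoc.prems by (cases s) auto
      then show ?thesis using s by (intro exI[of _ s']) auto
    next
      case False
      then show ?thesis using s by (intro exI[of _ "x # s"]) (auto simp: step_push)
    qed
  qed simp
  with that show thesis by blast
qed

lemma set_run:
  assumes "r \<notin> set p"
  shows "set (run [r] p) \<subseteq> insert r (set p)" and "hd (run [r] p) \<in> insert r (set p)"
    and "run [r] p \<noteq> []"
proof -
  obtain s where s: "run [r] p = s @ [r]" "set s \<subseteq> set p" using run_bottom[OF assms] .
  then show "set (run [r] p) \<subseteq> insert r (set p)" "run [r] p \<noteq> []" by auto
  then show "hd (run [r] p) \<in> insert r (set p)" using hd_in_set by blast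
qed

text \<open>Reading \<open>x\<close> pushes or pops one copy of \<open>x\<close>, which affects the
  parity on the stack just as appending \<open>x\<close> does in the word. The \<open>r\<close> in
  front accounts for the initial stack.\<close>

lemma parity_run:
  assumes "r \<notin> set p"
  shows "even (count_list (run [r] p) c) \<longleftrightarrow> even (count_list (r # p) c)"
  using assms
proof (induction p rule: rev_induct)
  case (snoc x p)
  then have "run [r] p \<noteq> []" using set_run(3)[of r p] by auto
  then obtain h t where "run [r] p = h # t" by (cases "run [r] p") auto
  with snoc show ?case by auto
qed simp

text \<open>A stack changes only at its top, so a nonempty lower part of it has itself been the
  whole stack at some moment.\<close>

lemma run_suffix:
  assumes "run [r] p = xs @ ys" and "ys \<noteq> []"
  shows "\<exists>q q'. p = q @ q' \<and> run [r] q = ys"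
  using assms
proof (induction p arbitrary: xs rule: rev_induct)
  case Nil
  then show ?case by (auto simp: Cons_eq_append_conv)
next
  case (snoc x p)
  show ?case
  proof (cases "hd (run [r] p) = x")
    case True
    with snoc.prems have tl: "tl (run [r] p) = xs @ ys" by (simp add: step_def[of "run [r] p"])
    with snoc.prems(2) have "run [r] p = (x # xs) @ ys"
      using True by (cases "run [r] p") auto
    then obtain q q' where "p = q @ q'" "run [r] q = ys" using snoc.IH snoc.prems(2) by blast
    then have "p @ [x] = q @ (q' @ [x]) \<and> run [r] q = ys" by simp
    then show ?thesis by blast
  next
    case False
    with snoc.prems have eq: "x # run [r] p = xs @ ys" by (simp add: step_push)
    show ?thesis
    proof (cases xs)
      case Nil
      then have "p @ [x] = (p @ [x]) @ [] \<and> run [r] (p @ [x]) = ys" using snoc.prems by auto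
      then show ?thesis by blast
    next
      case (Cons a list)
      then have "run [r] p = list @ ys" using eq by simp
      then obtain q q' where "p = q @ q'" "run [r] q = ys" using snoc.IH snoc.prems(2) by blast
      then have "p @ [x] = q @ (q' @ [x]) \<and> run [r] q = ys" by simp
      then show ?thesis by blast
    qed
  qed
qed

lemma visited_suffix:
  assumes "xs @ ys \<in> visited [r] w" and "ys \<noteq> []"
  shows "ys \<in> visited [r] w"
proof -
  obtain p q where "w = p @ q" "run [r] p = xs @ ys"
    using assms(1) by (auto simp: visited_def)
  moreover from this obtain t t' where "p = t @ t'" "run [r] t = ys"
    using run_suffix[OF _ assms(2)] by metis
  ultimately have "ys = run [r] t \<and> w = t @ (t' @ q)" by simp
  then show ?thesis unfolding visited_def by blast
qed

text \<open>If a letter occurred twice in a stack, the lower parts starting at the two occurrences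
  would be visited stacks with the same top but different lengths.\<close>

lemma tree_word_distinct:
  assumes "tree_word r w" and "s \<in> visited [r] w"
  shows "distinct s"
proof (rule ccontr)
  assume "\<not> distinct s"
  then obtain xs ys zs y where s: "s = xs @ [y] @ ys @ [y] @ zs"
    using not_distinct_decomp by blast
  have "y # ys @ y # zs \<in> visited [r] w" "y # zs \<in> visited [r] w"
    using visited_suffix[of xs "y # ys @ y # zs"] visited_suffix[of "xs @ y # ys" "y # zs"]
      assms(2) s by auto
  then have "y # ys @ y # zs = y # zs" using assms(1) unfolding tree_word_def
    by (metis list.sel(1))
  then show False by simp
qed

lemma visited_nonempty: "r \<notin> set w \<Longrightarrow> s \<in> visited [r] w \<Longrightarrow> s \<noteq> []"
  using set_run(3)[of r] by (auto simp: visited_def)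

text \<open>The top of \<open>s\<close> occurs in \<open>s'\<close>, and the part of
  \<open>s'\<close> from there down is a visited stack with that top, hence is \<open>s\<close>.
  Without repeated letters the two stacks have the same length, so nothing lies above that
  part.\<close>

lemma tree_word_stack_eq:
  assumes "tree_word r w" and "s \<in> visited [r] w" and "s' \<in> visited [r] w" and "set s = set s'"
  shows "s = s'"
proof -
  have ne: "s \<noteq> []" using assms(1,2) visited_nonempty[of r w s] by (simp add: tree_word_def)
  then obtain c t where s: "s = c # t" by (cases s) auto
  then obtain xs ys where s': "s' = xs @ c # ys" using assms(4) by (metis list.set_intros(1) split_list)
  then have "c # ys \<in> visited [r] w"
    using assms(3) visited_suffix[of xs "c # ys" r w] by auto
  then have "s = c # ys" using assms(1,2) s unfolding tree_word_def
    by (metis list.sel(1))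
  moreover have "length s = length s'"
    using distinct_card[OF tree_word_distinct[OF assms(1,2)]]
      distinct_card[OF tree_word_distinct[OF assms(1,3)]] assms(4) by simp
  ultimately show ?thesis using s' by simp
qed

lemma tree_word_parity_eq:
  assumes "tree_word r w" and "w = p @ q" and "w = p' @ q'"
    and "\<And>c. even (count_list p c) \<longleftrightarrow> even (count_list p' c)"
  shows "run [r] p = run [r] p'"
proof -
  have "r \<notin> set w" using assms(1) by (simp add: tree_word_def)
  moreover have "set p \<subseteq> set w" using assms(2) by simp
  moreover have "set p' \<subseteq> set w" using assms(3) by simp
  ultimately have r: "r \<notin> set p" "r \<notin> set p'" by blast+
  have v: "run [r] p \<in> visited [r] w" "run [r] p' \<in> visited [r] w"
    using assms(2,3) visitedI by metis+
  have mem: "c \<in> set s \<longleftrightarrow> odd (count_list s c)" if "distinct s" for s :: "'a list" and c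
    using that by (induction s) auto
  have "set (run [r] p) = set (run [r] p')"
    using mem[OF tree_word_distinct[OF assms(1) v(1)]] mem[OF tree_word_distinct[OF assms(1) v(2)]]
      parity_run[OF r(1)] parity_run[OF r(2)] assms(4) by auto
  then show ?thesis using tree_word_stack_eq assms(1) v by metis
qed

section \<open>Letters that occur in adjacent pairs\<close>

text \<open>
  \<open>balanced_letter z w\<close> expresses conditions (1) and (2) on the block of \<open>z\<close> through prefixes: cutting
  the even intervals into pairs, a pair starts at each occurrence of \<open>z\<close> preceded by an even number of
  \<open>z\<close>'s, and even gaps mean that the prefixes ending before two pairs have equal parities.
\<close>

definition paired :: "'a \<Rightarrow> 'a list \<Rightarrow> bool" where
  "paired z w \<longleftrightarrow> (\<forall>p x q. w = p @ z # x # q \<longrightarrow> even (count_list p z) \<longrightarrow> x = z)"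

definition balanced_letter :: "'a \<Rightarrow> 'a list \<Rightarrow> bool" where
  "balanced_letter z w \<longleftrightarrow> paired z w \<and> even (count_list w z) \<and>
     (\<forall>p q p' q' c. w = p @ z # q \<longrightarrow> w = p' @ z # q' \<longrightarrow>
        even (count_list p z) \<longrightarrow> even (count_list p' z) \<longrightarrow>
        even (count_list p c) = even (count_list p' c))"

abbreviation erase :: "'a \<Rightarrow> 'a list \<Rightarrow> 'a list" where
  "erase z \<equiv> filter (\<lambda>x. x \<noteq> z)"

lemma paired_prefix: "paired z (p @ q) \<Longrightarrow> paired z p"
  unfolding paired_def by (metis append.assoc append_Cons)

text \<open>A pair of adjacent \<open>z\<close> pushes \<open>z\<close> and pops it at once, so no
  letter ever lies above \<open>z\<close>, and the rest of the walk is that of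
  \<open>erase z p\<close>. An odd number of \<open>z\<close> means that \<open>p\<close> ends
  between the two letters of a pair.\<close>

lemma paired_run:
  assumes "paired z p" and "r \<notin> set p" and "z \<noteq> r"
  shows "if even (count_list p z) then run [r] p = run [r] (erase z p)
    else run [r] p = z # run [r] (erase z p) \<and> (\<exists>q. p = q @ [z])"
  using assms
proof (induction p rule: rev_induct)
  case (snoc x p)
  have IH: "if even (count_list p z) then run [r] p = run [r] (erase z p)
    else run [r] p = z # run [r] (erase z p) \<and> (\<exists>q. p = q @ [z])"
    using snoc.IH[OF paired_prefix[OF snoc.prems(1)]] snoc.prems by auto
  have hd: "hd (run [r] (erase z p)) \<noteq> z"
    using set_run(2)[of r "erase z p"] snoc.prems by auto
  show ?case
  proof (cases "even (count_list p z)")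
    case True
    then show ?thesis using IH hd by (auto simp: step_push)
  next
    case False
    then obtain q where q: "p = q @ [z]" using IH by auto
    then have "x = z"
      using snoc.prems(1) False unfolding paired_def by auto
    then show ?thesis using IH False by (auto simp: step_push)
  qed
qed simp

lemma erase_prefix:
  assumes "erase z w = p' @ q'"
  obtains p q where "w = p @ q" "erase z p = p'" "erase z q = q'"
proof -
  have "\<exists>p q. w = p @ q \<and> erase z p = p' \<and> erase z q = q'"
    using assms
  proof (induction w arbitrary: p')
    case (Cons x w)
    show ?case
    proof (cases "x \<noteq> z \<and> p' \<noteq> []")
      case True
      then obtain p'' where p': "p' = x # p''" "erase z w = p'' @ q'"
        using Cons.prems by (cases p') auto
      then obtain p q where "w = p @ q" "erase z p = p''" "erase z q = q'"
        using Cons.IH by blast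
      then have "x # w = (x # p) @ q \<and> erase z (x # p) = p' \<and> erase z q = q'"
        using True p' by simp
      then show ?thesis by blast
    next
      case False
      show ?thesis
      proof (cases "x = z")
        case True
        then obtain p q where "w = p @ q" "erase z p = p'" "erase z q = q'"
          using Cons by auto
        then have "x # w = (x # p) @ q \<and> erase z (x # p) = p' \<and> erase z q = q'"
          using True by simp
        then show ?thesis by blast
      next
        case False
        with \<open>\<not> (x \<noteq> z \<and> p' \<noteq> [])\<close> Cons.prems show ?thesis
          by (intro exI[of _ "[]"] exI[of _ "x # w"]) auto
      qed
    qed
  qed simp
  with that show thesis by blast
qed

lemma count_erase: "c \<noteq> z \<Longrightarrow> count_list (erase z p) c = count_list p c"
  by (induction p) auto

text \<open>A stack of \<open>w\<close> is one of the erased word or, inside a pair,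
  \<open>z\<close> on top of such a stack; the top tells which. In the first case the hypothesis on
  the erased word applies. In the second, equal parities before the two pairs give equal erased
  stacks by \<open>tree_word_parity_eq\<close>.\<close>

lemma tree_word_insert:
  assumes "balanced_letter z w" and "tree_word r (erase z w)" and "r \<notin> set w" and "z \<noteq> r"
  shows "tree_word r w"
proof -
  define w' where "w' = erase z w"
  have pz: "paired z w" and ev: "even (count_list w z)"
    and par: "\<And>p q p' q' c. w = p @ z # q \<Longrightarrow> w = p' @ z # q' \<Longrightarrow>
        even (count_list p z) \<Longrightarrow> even (count_list p' z) \<Longrightarrow>
        even (count_list p c) = even (count_list p' c)"
    using assms(1) unfolding balanced_letter_def by blast+
  have stack: "if even (count_list p z) then run [r] p = run [r] (erase z p)
    else run [r] p = z # run [r] (erase z p) \<and> (\<exists>q. p = q @ [z])" if "w = p @ q" for p q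
    using paired_run[OF paired_prefix[OF pz[unfolded that]]] that assms(3,4) by auto
  have vis': "run [r] (erase z p) \<in> visited [r] w'" if "w = p @ q" for p q
    using that unfolding visited_def w'_def by auto
  have hd': "hd s \<noteq> z" if "s \<in> visited [r] w'" for s
  proof -
    obtain p q where "s = run [r] p" "erase z w = p @ q"
      using \<open>s \<in> visited [r] w'\<close> by (auto simp: visited_def w'_def)
    moreover from this have "set p \<subseteq> set w - {z}" by (metis Un_upper1 set_append set_filter set_minus_filter_out)
    ultimately show ?thesis using set_run(2)[of r p] assms(3,4) by auto
  qed
  have eq': "s = s'" if "s \<in> visited [r] w'" "s' \<in> visited [r] w'" "hd s = hd s'" for s s'
    using assms(2) that unfolding tree_word_def w'_def by blast
  have eq: "run [r] p1 = run [r] p2"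
    if w: "w = p1 @ q1" "w = p2 @ q2" and hd: "hd (run [r] p1) = hd (run [r] p2)" for p1 q1 p2 q2
  proof (cases "even (count_list p1 z)"; cases "even (count_list p2 z)")
    assume "odd (count_list p1 z)" "odd (count_list p2 z)"
    then obtain t1 t2 where t: "p1 = t1 @ [z]" "p2 = t2 @ [z]"
      and run: "run [r] p1 = z # run [r] (erase z p1)" "run [r] p2 = z # run [r] (erase z p2)"
      using stack[OF w(1)] stack[OF w(2)] by auto
    have "even (count_list t1 c) = even (count_list t2 c)" for c
      using par[of t1 q1 t2 q2 c] w t \<open>odd (count_list p1 z)\<close> \<open>odd (count_list p2 z)\<close> by auto
    then have "even (count_list (erase z p1) c) = even (count_list (erase z p2) c)" for c
      using t by (cases "c = z") (auto simp: count_erase count_list_0_iff)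
    then have "run [r] (erase z p1) = run [r] (erase z p2)"
      using tree_word_parity_eq[OF assms(2), of "erase z p1" "erase z q1" "erase z p2" "erase z q2"]
        w by (metis filter_append)
    then show ?thesis using run by simp
  qed (use stack[OF w(1)] stack[OF w(2)] hd'[OF vis'[OF w(1)]] hd'[OF vis'[OF w(2)]] hd
      eq'[OF vis'[OF w(1)] vis'[OF w(2)]] in auto)
  have "run [r] w = [r]"
    using stack[of w "[]"] ev assms(2) by (auto simp: tree_word_def)
  then show ?thesis
    using eq assms(3) unfolding tree_word_def visited_def by blast
qed

text \<open>By \<open>last\<close>, every other letter occurs before the first \<open>z\<close>. A
  letter pushed onto \<open>z\<close> would thus also have been on top of a stack without
  \<open>z\<close>, although stacks are determined by their tops. So each \<open>z\<close> is popped
  at once, which yields the pairs; all stacks with top \<open>z\<close> being the same yields the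
  equal parities.\<close>

lemma tree_word_remove:
  assumes "tree_word r w" and "z \<in> set w"
    and last: "\<And>p q. w = p @ z # q \<Longrightarrow> z \<notin> set p \<Longrightarrow> set w \<subseteq> insert z (set p)"
  shows "balanced_letter z w" and "tree_word r (erase z w)"
proof -
  have r: "r \<notin> set w" and fin: "run [r] w = [r]"
    and T: "\<And>s s'. s \<in> visited [r] w \<Longrightarrow> s' \<in> visited [r] w \<Longrightarrow> hd s = hd s' \<Longrightarrow> s = s'"
    using assms(1) unfolding tree_word_def by blast+
  have z: "z \<noteq> r" using assms(2) r by auto
  have vis: "run [r] p \<in> visited [r] w" if "w = p @ q" for p q
    using that by (auto simp: visited_def)
  have leaf: "x = z" if w: "w = p @ x # q" and top: "run [r] p = z # s" for p x q s
  proof (rule ccontr)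
    assume "x \<noteq> z"
    obtain p0 q0 where 0: "w = p0 @ z # q0" "z \<notin> set p0"
      using assms(2) split_list_first by metis
    moreover have "x \<in> set w" using w by simp
    ultimately have "x \<in> set p0" using last[OF 0] \<open>x \<noteq> z\<close> by blast
    then obtain p1 p2 where 1: "p0 = p1 @ x # p2" "x \<notin> set p1"
      using split_list_first by metis
    have r1: "r \<notin> set p1" "x \<noteq> r" using r 0 1 by auto
    have "hd (run [r] p1) \<noteq> x" using set_run(2)[OF r1(1)] 1 r1 by auto
    then have run1: "run [r] (p1 @ [x]) = x # run [r] p1" by (simp add: step_push)
    have run2: "run [r] (p @ [x]) = x # z # s" using top \<open>x \<noteq> z\<close> by (simp add: step_push)
    have "run [r] (p1 @ [x]) = run [r] (p @ [x])"
      using T[OF vis vis, of "p1 @ [x]" _ "p @ [x]"] run1 run2 w 0 1 by auto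
    then have "z \<in> set (run [r] p1)" using run1 run2 by auto
    then show False using set_run(1)[OF r1(1)] 0 1 z by auto
  qed
  \<comment> \<open>\<open>paired_run\<close> gives the stack only for a paired prefix, while the
    letter after an opening \<open>z\<close> is known only from the stack; hence the induction over
    prefixes.\<close>
  have prefix_paired: "paired z p" if "w = p @ q" for p q
    using that
  proof (induction p arbitrary: q rule: rev_induct)
    case (snoc x p)
    then have IH: "paired z p" by auto
    have X: "x = z" if "p = t @ [z]" "even (count_list t z)" for t
    proof -
      have "run [r] p = z # run [r] (erase z p)"
        using paired_run[OF IH _ z] snoc.prems r that by auto
      then show ?thesis using leaf snoc.prems by auto
    qed
    have Y: "y = z" if "p @ [x] = t @ z # y # t'" "even (count_list t z)" "t' = u @ [v]"
      for t y t' u v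
      using IH that unfolding paired_def by auto
    show ?case unfolding paired_def
    proof (intro allI impI)
      fix t y t'
      assume eq: "p @ [x] = t @ z # y # t'" and ev: "even (count_list t z)"
      show "y = z"
      proof (cases t' rule: rev_cases)
        case Nil
        then have "p @ [x] = (t @ [z]) @ [y]" using eq by simp
        then show ?thesis using X ev by (metis append1_eq_conv)
      next
        case (snoc u v)
        then show ?thesis using Y eq ev by blast
      qed
    qed
  qed (auto simp: paired_def)
  have stack: "if even (count_list p z) then run [r] p = run [r] (erase z p)
    else run [r] p = z # run [r] (erase z p) \<and> (\<exists>q. p = q @ [z])" if "w = p @ q" for p q
    using paired_run[of z p r] that prefix_paired r z by auto
  have ev: "even (count_list w z)"
    using stack[of w "[]"] fin z by (auto split: if_splits)
  have push: "run [r] (p @ [z]) = z # run [r] p" if "w = p @ z # q" "even (count_list p z)" for p q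
    using stack[of "p @ [z]" q] stack[of p "z # q"] that by (auto split: if_splits)
  have "even (count_list p c) = even (count_list p' c)"
    if "w = p @ z # q" "w = p' @ z # q'" "even (count_list p z)" "even (count_list p' z)"
    for p q p' q' c
  proof -
    have "run [r] (p @ [z]) = run [r] (p' @ [z])"
      using T[OF vis vis, of "p @ [z]" q "p' @ [z]" q'] push[OF that(1,3)] push[OF that(2,4)]
        that(1,2) by simp
    then have "run [r] p = run [r] p'" using push[OF that(1,3)] push[OF that(2,4)] by simp
    moreover have "set p \<subseteq> set w" using that(1) by auto
    moreover have "set p' \<subseteq> set w" using that(2) by auto
    ultimately have "r \<notin> set p" "r \<notin> set p'" "run [r] p = run [r] p'" using r by blast+
    then show ?thesis using parity_run[of r p c] parity_run[of r p' c] by (auto split: if_splits)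
  qed
  moreover have "paired z w" using prefix_paired[of w "[]"] by simp
  ultimately show "balanced_letter z w"
    unfolding balanced_letter_def using ev by blast
  \<comment> \<open>An erased prefix is lifted to a prefix of \<open>w\<close>; if that one stops
    inside a pair, dropping its last \<open>z\<close> gives the stack wanted.\<close>
  have "visited [r] (erase z w) \<subseteq> visited [r] w"
  proof
    fix s assume "s \<in> visited [r] (erase z w)"
    then obtain p q where w: "w = p @ q" and s: "s = run [r] (erase z p)"
      unfolding visited_def by (auto elim!: erase_prefix)
    show "s \<in> visited [r] w"
    proof (cases "even (count_list p z)")
      case True
      then show ?thesis using stack[OF w] vis[OF w] s by auto
    next
      case False
      then obtain t where "p = t @ [z]" using stack[OF w] by auto
      with False w s show ?thesis using stack[of t "z # q"] vis[of t "z # q"] by auto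
    qed
  qed
  then show "tree_word r (erase z w)"
    using T stack[of w "[]"] ev fin r unfolding tree_word_def by auto
qed

section \<open>Positions and even intervals\<close>

definition positions :: "'a list \<Rightarrow> 'a \<Rightarrow> nat set" where
  "positions w c = {p \<in> {1..length w}. w ! (p - 1) = c}"

lemma word_partition_positions: "word_partition w = positions w ` set w"
  by (simp add: word_partition_def positions_def)

lemma positions_Nil [simp]: "positions [] c = {}"
  by (auto simp: positions_def)

lemma positions_snoc:
  "positions (w @ [x]) c = (if x = c then insert (Suc (length w)) (positions w c) else positions w c)"
  by (auto simp: positions_def nth_append le_Suc_eq)

lemma positions_subset: "positions w c \<subseteq> {1..length w}"
  by (auto simp: positions_def)

lemma finite_positions [simp]: "finite (positions w c)"
  by (rule finite_subset[OF positions_subset]) simp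

lemma mem_positions_append: "Suc (length p) \<in> positions (p @ x # q) c \<longleftrightarrow> x = c"
  by (auto simp: positions_def)

lemma mem_positionsE:
  assumes "i \<in> positions w c"
  obtains p q where "w = p @ c # q" "i = Suc (length p)"
proof -
  have "i - 1 < length w" "w ! (i - 1) = c" "i = Suc (i - 1)"
    using assms by (auto simp: positions_def)
  then have "w = take (i - 1) w @ c # drop i w" "i = Suc (length (take (i - 1) w))"
    using id_take_nth_drop[of "i - 1" w] by simp_all
  then show thesis by (rule that)
qed

lemma positions_empty_iff: "positions w c = {} \<longleftrightarrow> c \<notin> set w"
proof
  show "positions w c = {}" if "c \<notin> set w"
    using that by (auto elim!: mem_positionsE)
  show "c \<notin> set w" if "positions w c = {}"
    using that mem_positions_append[of _ c _ c] by (auto dest!: split_list)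
qed

lemma positions_disjoint: "c \<noteq> d \<Longrightarrow> positions w c \<inter> positions w d = {}"
  by (auto simp: positions_def)

lemma positions_eq_iff: "c \<in> set w \<Longrightarrow> positions w c = positions w d \<longleftrightarrow> c = d"
  using positions_disjoint[of c d w] positions_empty_iff[of w c] by auto

lemma positions_Un: "(\<Union>c\<in>set w. positions w c) = {1..length w}"
  by (force simp: positions_def)

lemma card_positions: "card (positions w c) = count_list w c"
proof (induction w rule: rev_induct)
  case (snoc x w)
  moreover have "Suc (length w) \<notin> positions w c" using positions_subset[of w c] by auto
  ultimately show ?case by (simp add: positions_snoc)
qed simp

lemma positions_initial: "positions (p @ q) c \<inter> {..length p} = positions p c"
  by (auto simp: positions_def nth_append)

lemma count_initial: "w = p @ q \<Longrightarrow> count_list p c = card (positions w c \<inter> {..<Suc (length p)})"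
  by (simp add: positions_initial card_positions lessThan_Suc_atMost)

lemma Min_ivl: "0 < n \<Longrightarrow> Min {a..<a + 2 * n} = (a::nat)"
  by (intro Min_eqI) auto

lemma Max_ivl: "0 < n \<Longrightarrow> Max {a..<a + 2 * n} = (a + 2 * n - 1 ::nat)"
  by (intro Max_eqI) auto

lemma increasing_even_intervals_order:
  assumes "increasing_even_intervals Is" and "i < j" "j < length Is" and "x \<in> Is ! i" "y \<in> Is ! j"
  shows "x < y"
proof -
  have ivl: "\<exists>a n. 0 < n \<and> Is ! k = {a..<a + 2 * n}" if "k < length Is" for k
    using assms(1) that unfolding increasing_even_intervals_def by auto
  have fin: "finite (Is ! i)" "finite (Is ! j)"
    using ivl[of i] ivl[of j] assms(2,3) by auto
  have "Max (Is ! i) < Min (Is ! j)"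
    using assms(1-3) unfolding increasing_even_intervals_def by (simp add: sorted_wrt_iff_nth_less)
  moreover have "x \<le> Max (Is ! i)" "Min (Is ! j) \<le> y" using fin assms(4,5) by auto
  ultimately show ?thesis by linarith
qed

lemma even_card_intervals:
  "increasing_even_intervals Is \<Longrightarrow> finite (\<Union>(set Is)) \<and> even (card (\<Union>(set Is)))"
proof (induction Is)
  case (Cons I Is)
  have inc: "increasing_even_intervals Is"
    using Cons.prems by (auto simp: increasing_even_intervals_def)
  obtain a n where I: "0 < n" "I = {a..<a + 2 * n}"
    using Cons.prems by (auto simp: increasing_even_intervals_def)
  have "I \<inter> \<Union>(set Is) = {}"
  proof (rule ccontr)
    assume "I \<inter> \<Union>(set Is) \<noteq> {}"
    then obtain x j where "x \<in> I" "x \<in> Is ! j" "j < length Is" by (auto simp: in_set_conv_nth)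
    then show False
      using increasing_even_intervals_order[OF Cons.prems, of 0 "Suc j" x x] by auto
  qed
  then show ?case using Cons.IH[OF inc] I by (auto simp: card_Un_disjoint)
qed simp

text \<open>Below an interval lie exactly the intervals before it in the list, which again form an
  increasing list of even intervals.\<close>

lemma even_card_below_interval:
  assumes "increasing_even_intervals Is" and "j < length Is" and "Is ! j = {a..<a + 2 * n}" and "0 < n"
  shows "even (card (\<Union>(set Is) \<inter> {..<a}))"
proof -
  have mem: "a \<in> Is ! j" "Is ! j \<inter> {..<a} = {}" using assms(3,4) by auto
  have "\<Union>(set Is) \<inter> {..<a} = \<Union>(set (take j Is))"
  proof (intro equalityI subsetI)
    fix x assume "x \<in> \<Union>(set Is) \<inter> {..<a}"
    then obtain i where i: "i < length Is" "x \<in> Is ! i" "x < a" by (auto simp: in_set_conv_nth)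
    have "i < j"
    proof (rule ccontr)
      assume "\<not> i < j"
      then consider "i = j" | "j < i" by linarith
      then show False
        using increasing_even_intervals_order[OF assms(1), of j i a x] i mem by cases auto
    qed
    then have "Is ! i \<in> set (take j Is)" using i(1) by (auto simp: in_set_conv_nth)
    then show "x \<in> \<Union>(set (take j Is))" using i(2) by blast
  next
    fix x assume "x \<in> \<Union>(set (take j Is))"
    then obtain i where i: "i < j" "x \<in> Is ! i" by (auto simp: in_set_conv_nth)
    then show "x \<in> \<Union>(set Is) \<inter> {..<a}"
      using increasing_even_intervals_order[OF assms(1) i(1) assms(2) i(2) mem(1)] assms(2)
      by (auto intro!: bexI[of _ "Is ! i"])
  qed
  moreover have "increasing_even_intervals (take j Is)"
    using assms(1) by (auto simp: increasing_even_intervals_def sorted_wrt_take dest: in_set_takeD)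
  ultimately show ?thesis using even_card_intervals by metis
qed

text \<open>The earlier intervals hold evenly many \<open>z\<close>, so an opening \<open>z\<close>
  has even offset in its interval, and the next position belongs to the interval too. The number of
  another letter before an opening \<open>z\<close> is its number before the interval, and this
  grows from one interval to the next by the even content of a gap.\<close>

lemma balanced_letter_of_intervals:
  assumes inc: "increasing_even_intervals Is" and V: "positions w z = \<Union>(set Is)"
    and gap: "\<And>c j. c \<in> set w \<Longrightarrow> c \<noteq> z \<Longrightarrow> Suc j < length Is \<Longrightarrow>
      even (card (positions w c \<inter> ({Min (Is ! j)..Max (Is ! Suc j)} - (Is ! j \<union> Is ! Suc j))))"
  shows "balanced_letter z w"
proof -
  define lo where "lo j = Min (Is ! j)" for j
  have ivl: "\<exists>n>0. Is ! j = {lo j..<lo j + 2 * n}" if "j < length Is" for j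
  proof -
    have "Is ! j \<in> set Is" using that by simp
    then obtain a n where an: "0 < n" "Is ! j = {a..<a + 2 * n}"
      using inc unfolding increasing_even_intervals_def by blast
    then have "lo j = a" by (simp add: lo_def Min_ivl)
    then show ?thesis using an by blast
  qed
  \<comment> \<open>Occurrences of \<open>c\<close> to the left of interval \<open>j\<close>;
    \<open>const\<close> shows that the parity does not depend on \<open>j\<close>.\<close>
  define A where "A c j = card (positions w c \<inter> {..<lo j})" for c j
  have start: "\<exists>j n. j < length Is \<and> 0 < n \<and> Is ! j = {lo j..<lo j + 2 * n} \<and>
      Suc (length p) \<in> Is ! j \<and> even (Suc (length p) - lo j)"
    if w: "w = p @ z # q" and ev: "even (count_list p z)" for p q
  proof -
    have "Suc (length p) \<in> positions w z" using w by (simp add: mem_positions_append)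
    then obtain j where j: "j < length Is" "Suc (length p) \<in> Is ! j"
      using V by (auto simp: in_set_conv_nth)
    obtain n where n: "0 < n" "Is ! j = {lo j..<lo j + 2 * n}" using ivl[OF j(1)] by blast
    define a where "a = lo j"
    have a: "Is ! j = {a..<a + 2 * n}" "a \<le> Suc (length p)" "Suc (length p) < a + 2 * n"
      using n j a_def by (metis, metis atLeastLessThan_iff, metis atLeastLessThan_iff)
    have "{a..<a + 2 * n} \<subseteq> positions w z" using V j(1) a(1) nth_mem by blast
    then have "positions w z \<inter> {..<Suc (length p)} = (\<Union>(set Is) \<inter> {..<a}) \<union> {a..<Suc (length p)}"
      using a V by auto
    moreover have "card ((\<Union>(set Is) \<inter> {..<a}) \<union> {a..<Suc (length p)})
        = card (\<Union>(set Is) \<inter> {..<a}) + (Suc (length p) - a)"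
      by (subst card_Un_disjoint) auto
    ultimately have "even (Suc (length p) - a)"
      using ev count_initial[OF w, of z] even_card_below_interval[OF inc j(1) a(1) n(1)] by simp
    then show ?thesis using j n a_def by blast
  qed
  have "paired z w"
    unfolding paired_def
  proof (intro allI impI)
    fix p x q assume w: "w = p @ z # x # q" and ev: "even (count_list p z)"
    then obtain j n where j: "j < length Is" "0 < n" "Is ! j = {lo j..<lo j + 2 * n}"
      "Suc (length p) \<in> Is ! j" "even (Suc (length p) - lo j)"
      using start by blast
    define a where "a = lo j"
    have a: "Is ! j = {a..<a + 2 * n}" "a \<le> Suc (length p)" "Suc (length p) < a + 2 * n"
      "even (Suc (length p) - a)"
      using j a_def by (metis, metis atLeastLessThan_iff, metis atLeastLessThan_iff, metis)
    \<comment> \<open>In an interval of even length, the last offset is odd.\<close>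
    then have "Suc (Suc (length p)) < a + 2 * n" by presburger
    then have "Suc (Suc (length p)) \<in> Is ! j" using a by auto
    then have "Suc (length (p @ [z])) \<in> positions ((p @ [z]) @ x # q) z" using V w j(1) nth_mem by fastforce
    then show "x = z" unfolding mem_positions_append .
  qed
  moreover have "even (count_list w z)"
    using even_card_intervals[OF inc] V card_positions[of w z] by simp
  moreover have "even (count_list p c) = even (count_list p' c)"
    if w: "w = p @ z # q" "w = p' @ z # q'" and ev: "even (count_list p z)" "even (count_list p' z)"
    for p q p' q' c
  proof (cases "c \<in> set w \<and> c \<noteq> z")
    case False
    moreover have "set p \<subseteq> set w" using w(1) by auto
    moreover have "set p' \<subseteq> set w" using w(2) by auto
    ultimately show ?thesis using ev by (metis count_list_0_iff subsetD)
  next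
    case True
    have out: "positions w c \<inter> \<Union>(set Is) = {}" using positions_disjoint[of c z w] True V by simp
    have const: "even (A c j) = even (A c 0)" if "j < length Is" for j
      using that
    proof (induction j)
      case (Suc j)
      obtain n n' where j: "0 < n" "Is ! j = {lo j..<lo j + 2 * n}"
        and j': "0 < n'" "Is ! Suc j = {lo (Suc j)..<lo (Suc j) + 2 * n'}"
        using ivl[of j] ivl[OF Suc.prems] Suc.prems by auto
      define a a' where "a = lo j" and "a' = lo (Suc j)"
      note j = j[folded a_def] note j' = j'[folded a'_def]
      have aa: "a < a'"
        using increasing_even_intervals_order[OF inc, of j "Suc j" a a'] j j' Suc.prems by auto
      have mx: "Max (Is ! Suc j) = a' + 2 * n' - 1" using j' Max_ivl by metis
      define G where "G = positions w c \<inter> ({a..Max (Is ! Suc j)} - (Is ! j \<union> Is ! Suc j))"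
      have "Is ! j \<in> set Is" "Is ! Suc j \<in> set Is" using Suc.prems by auto
      then have out2: "positions w c \<inter> Is ! j = {}" "positions w c \<inter> Is ! Suc j = {}" using out by blast+
      \<comment> \<open>Both intervals are filled with \<open>z\<close>, so between their left ends
        \<open>c\<close> occurs only in the gap. \<open>G\<close> extends to the right end of the
        second interval merely to have the form used in condition (2).\<close>
      have "positions w c \<inter> {..<a'} = (positions w c \<inter> {..<a}) \<union> G"
      proof (intro equalityI subsetI)
        fix x assume x: "x \<in> positions w c \<inter> {..<a'}"
        then have "x \<notin> Is ! j \<union> Is ! Suc j" using out2 by blast
        then show "x \<in> positions w c \<inter> {..<a} \<union> G" using x mx j'(1) by (auto simp: G_def)
      next
        fix x assume x: "x \<in> (positions w c \<inter> {..<a}) \<union> G"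
        show "x \<in> positions w c \<inter> {..<a'}"
        proof (cases "x \<in> G")
          case True
          then have "x \<notin> {a'..<a' + 2 * n'}" "x \<le> a' + 2 * n' - 1" "x \<in> positions w c"
            using mx j'(2) by (auto simp: G_def)
          then show ?thesis using j'(1) by auto
        qed (use x aa in auto)
      qed
      moreover have "card ((positions w c \<inter> {..<a}) \<union> G) = A c j + card G"
        unfolding A_def a_def[symmetric] by (subst card_Un_disjoint) (auto simp: G_def)
      moreover have "even (card G)" unfolding G_def a_def lo_def using gap True Suc.prems by blast
      ultimately have "even (A c (Suc j)) = even (A c j)" unfolding A_def a'_def[symmetric] by simp
      then show ?case using Suc by simp
    qed simp
    have base: "even (count_list p c) = even (A c 0)"
      if w: "w = p @ z # q" and ev: "even (count_list p z)" for p q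
    proof -
      obtain j n where j: "j < length Is" "0 < n" "Is ! j = {lo j..<lo j + 2 * n}"
        "Suc (length p) \<in> Is ! j"
        using start[OF w ev] by blast
      define a where "a = lo j"
      have a: "Is ! j = {a..<a + 2 * n}" "a \<le> Suc (length p)" "Suc (length p) < a + 2 * n"
        using j a_def by (metis, metis atLeastLessThan_iff, metis atLeastLessThan_iff)
      have "positions w c \<inter> {a..<a + 2 * n} = {}" using out j(1) a(1) nth_mem by blast
      then have "positions w c \<inter> {..<Suc (length p)} = positions w c \<inter> {..<a}"
        using a by (auto simp: disjoint_iff)
      then show ?thesis using count_initial[OF w, of c] const[OF j(1)] by (simp add: A_def a_def)
    qed
    show ?thesis using base[OF w(1) ev(1)] base[OF w(2) ev(2)] by simp
  qed
  ultimately show ?thesis unfolding balanced_letter_def by blast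
qed

text \<open>Each pair \<open>zz\<close> is taken as an interval of its own. Intervals may touch, so
  maximal runs need not be formed, and the content of the gap between successive pairs is a
  difference of two prefix counts of equal parity.\<close>

lemma intervals_of_balanced_letter:
  assumes "balanced_letter z w"
  obtains Is where "increasing_even_intervals Is" "positions w z = \<Union>(set Is)"
    "\<And>c j. c \<noteq> z \<Longrightarrow> Suc j < length Is \<Longrightarrow>
      even (card (positions w c \<inter> ({Min (Is ! j)..Max (Is ! Suc j)} - (Is ! j \<union> Is ! Suc j))))"
proof -
  have pz: "paired z w" and ev: "even (count_list w z)"
    and par: "\<And>p q p' q' c. w = p @ z # q \<Longrightarrow> w = p' @ z # q' \<Longrightarrow>
        even (count_list p z) \<Longrightarrow> even (count_list p' z) \<Longrightarrow>
        even (count_list p c) = even (count_list p' c)"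
    using assms unfolding balanced_letter_def by blast+
  define Op where "Op = {Suc (length p) | p q. w = p @ z # q \<and> even (count_list p z)}"
  have O_pos: "Op \<subseteq> positions w z" unfolding Op_def by (auto simp: mem_positions_append)
  have fin: "finite Op" by (rule finite_subset[OF O_pos]) simp
  have next_pos: "Suc i \<in> positions w z" if "i \<in> Op" for i
  proof -
    obtain p q where p: "w = p @ z # q" "even (count_list p z)" "i = Suc (length p)"
      using \<open>i \<in> Op\<close> unfolding Op_def by blast
    have "q \<noteq> []" using p ev by auto
    then obtain y q' where q: "q = y # q'" by (cases q) auto
    then have "y = z" using pz p unfolding paired_def by blast
    then show ?thesis using mem_positions_append[of "p @ [z]" z q' z] p q by simp
  qed
  have next_O: "Suc i \<notin> Op" if "i \<in> Op" for i
  proof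
    assume "Suc i \<in> Op"
    then obtain p' q' where p': "w = p' @ z # q'" "even (count_list p' z)" "i = length p'"
      unfolding Op_def by auto
    obtain p q where p: "w = p @ z # q" "even (count_list p z)" "i = Suc (length p)"
      using \<open>i \<in> Op\<close> unfolding Op_def by blast
    have "p' = p @ [z]" using p(1,3) p'(1,3) by (metis append.assoc append_Cons append_Nil
          append_eq_append_conv length_append_singleton)
    then show False using p p' by simp
  qed
  have cover: "i \<in> Op \<or> (\<exists>i'\<in>Op. i = Suc i')" if i: "i \<in> positions w z" for i
  proof -
    obtain p q where p: "w = p @ z # q" "i = Suc (length p)" using i by (rule mem_positionsE)
    show ?thesis
    proof (cases "even (count_list p z)")
      case True
      then show ?thesis using p unfolding Op_def by blast
    next
      case False
      \<comment> \<open>The last \<open>z\<close> before position \<open>i\<close> opens a pair, and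
        pairedness puts its partner directly behind it, so that nothing lies between the
        two.\<close>
      then have "z \<in> set p" using count_notin by fastforce
      then obtain p1 p2 where 1: "p = p1 @ z # p2" "z \<notin> set p2" using split_list_last by metis
      then have ev1: "even (count_list p1 z)" using False by auto
      have "p2 = []"
      proof (rule ccontr)
        assume "p2 \<noteq> []"
        then obtain y p3 where "p2 = y # p3" by (cases p2) auto
        then show False using pz ev1 1 p unfolding paired_def by fastforce
      qed
      then have "Suc (length p1) \<in> Op" "i = Suc (Suc (length p1))"
        using 1 p ev1 by (auto simp: Op_def)
      then show ?thesis by blast
    qed
  qed
  define os where "os = sorted_list_of_set Op"
  define Is where "Is = map (\<lambda>i. {i..<i + 2 * 1}) os"
  have os: "set os = Op" "sorted_wrt (<) os" using fin by (simp_all add: os_def)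
  have len: "length Is = length os" by (simp add: Is_def)
  have nth: "Is ! j = {os ! j..<os ! j + 2 * 1}" if "j < length os" for j using that by (simp add: Is_def)
  have inc: "increasing_even_intervals Is"
    unfolding increasing_even_intervals_def
  proof
    show "\<forall>I\<in>set Is. \<exists>a n. 0 < n \<and> I = {a..<a + 2 * n}" by (force simp: Is_def)
    have "os ! i + 1 < os ! j" if "i < j" "j < length os" for i j
    proof -
      have "os ! i \<in> Op" "os ! j \<in> Op" using that os(1) by auto
      moreover have "os ! i < os ! j" using os(2) that by (simp add: sorted_wrt_iff_nth_less)
      ultimately show ?thesis using next_O[of "os ! i"] by (metis Suc_eq_plus1 Suc_lessI)
    qed
    then show "sorted_wrt (\<lambda>I J. Max I < Min J) Is"
      unfolding sorted_wrt_iff_nth_less len using Min_ivl[of 1] Max_ivl[of 1] by (auto simp: nth)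
  qed
  have Is_Un: "\<Union>(set Is) = (\<Union>i\<in>Op. {i, Suc i})" using os(1) by (auto simp: Is_def)
  have V: "positions w z = \<Union>(set Is)"
  proof (intro equalityI subsetI)
    fix i assume "i \<in> positions w z"
    then show "i \<in> \<Union>(set Is)" using cover[of i] unfolding Is_Un by blast
  next
    fix i assume "i \<in> \<Union>(set Is)"
    then obtain i' where "i' \<in> Op" "i = i' \<or> i = Suc i'" unfolding Is_Un by blast
    then show "i \<in> positions w z" using O_pos next_pos by blast
  qed
  have gap: "even (card (positions w c \<inter> ({Min (Is ! j)..Max (Is ! Suc j)} - (Is ! j \<union> Is ! Suc j))))"
    if c: "c \<noteq> z" and j: "Suc j < length Is" for c j
  proof -
    define i i' where "i = os ! j" and "i' = os ! Suc j"
    have mem: "i \<in> Op" "i' \<in> Op" using j len os(1) by (auto simp: i_def i'_def)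
    have less: "i < i'" using os(2) j len by (simp add: sorted_wrt_iff_nth_less i_def i'_def)
    have less2: "Suc i < i'" using less next_O mem by (metis Suc_lessI)
    have eqs: "Is ! j = {i..<i + 2 * 1}" "Is ! Suc j = {i'..<i' + 2 * 1}"
      using nth j len by (auto simp: i_def i'_def)
    have pos: "{i, Suc i, i', Suc i'} \<inter> positions w c = {}"
      using O_pos next_pos mem positions_disjoint[OF c, of w] by blast
    \<comment> \<open>The four positions of the two pairs carry \<open>z\<close>, so leaving them
      out does not affect the occurrences of \<open>c\<close>.\<close>
    have E1: "positions w c \<inter> ({i..i' + 2 * 1 - 1} - ({i..<i + 2 * 1} \<union> {i'..<i' + 2 * 1}))
      = (positions w c \<inter> {..<i'}) - (positions w c \<inter> {..<i})"
    proof (intro equalityI subsetI)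
      fix x assume x: "x \<in> positions w c \<inter> ({i..i' + 2 * 1 - 1} - ({i..<i + 2 * 1} \<union> {i'..<i' + 2 * 1}))"
      then show "x \<in> (positions w c \<inter> {..<i'}) - (positions w c \<inter> {..<i})" by auto
    next
      fix x assume x: "x \<in> (positions w c \<inter> {..<i'}) - (positions w c \<inter> {..<i})"
      then have "x \<noteq> i" "x \<noteq> Suc i" using pos by auto
      then show "x \<in> positions w c \<inter> ({i..i' + 2 * 1 - 1} - ({i..<i + 2 * 1} \<union> {i'..<i' + 2 * 1}))"
        using x by auto
    qed
    have E2: "card ((positions w c \<inter> {..<i'}) - (positions w c \<inter> {..<i}))
      = card (positions w c \<inter> {..<i'}) - card (positions w c \<inter> {..<i})"
      by (rule card_Diff_subset) (use less in auto)
    have E3: "even (card (positions w c \<inter> {..<i'})) = even (card (positions w c \<inter> {..<i}))"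
    proof -
      obtain p q p' q' where "w = p @ z # q" "even (count_list p z)" "i = Suc (length p)"
        "w = p' @ z # q'" "even (count_list p' z)" "i' = Suc (length p')"
        using mem unfolding Op_def by blast
      then show ?thesis using par[of p q p' q' c] count_initial by metis
    qed
    have "even (card (positions w c \<inter>
        ({i..i' + 2 * 1 - 1} - ({i..<i + 2 * 1} \<union> {i'..<i' + 2 * 1}))))"
      unfolding E1 E2 even_diff_nat even_add using E3 by simp
    moreover have "Min (Is ! j) = i" "Max (Is ! Suc j) = i' + 2 * 1 - 1"
      unfolding eqs by (rule Min_ivl Max_ivl; simp)+
    ultimately show ?thesis unfolding eqs by simp
  qed
  show thesis by (rule that[OF inc V gap])
qed

section \<open>Special symmetric words\<close>

lemma length_erase: "length (erase z w) + count_list w z = length w"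
  by (induction w) auto

lemma card_remaining_positions: "card ({1..length w} - positions w z) = length (erase z w)"
  using length_erase[of z w] card_Diff_subset[OF finite_positions positions_subset, of w z]
    card_positions[of w z] by simp

text \<open>Appending a letter changes no earlier rank, and the new position, if it survives, gets
  as its rank the number of all surviving positions.\<close>

lemma relabel_positions:
  assumes "c \<noteq> z"
  shows "(\<lambda>x. card {y \<in> {1..length w} - positions w z. y \<le> x}) ` positions w c
    = positions (erase z w) c"
proof (induction w rule: rev_induct)
  case (snoc a w)
  define rk where "rk w x = card {y \<in> {1..length w} - positions w z. y \<le> x}" for w x
  have "rk (w @ [a]) x = rk w x" if "x \<in> positions w c" for x
  proof -
    have "x \<le> length w" using that positions_subset[of w c] by auto
    then have "{y \<in> {1..length (w @ [a])} - positions (w @ [a]) z. y \<le> x}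
        = {y \<in> {1..length w} - positions w z. y \<le> x}"
      by (auto simp: positions_snoc)
    then show ?thesis by (simp add: rk_def)
  qed
  then have IH: "rk (w @ [a]) ` positions w c = positions (erase z w) c"
    using snoc by (simp add: rk_def[abs_def])
  have "rk (w @ [a]) ` positions (w @ [a]) c = positions (erase z (w @ [a])) c"
  proof (cases "a = c")
    case False
    then show ?thesis using IH by (simp add: positions_snoc)
  next
    case True
    have eq: "{y \<in> {1..length (w @ [a])} - positions (w @ [a]) z. y \<le> Suc (length w)}
        = {1..length (w @ [a])} - positions (w @ [a]) z" by auto
    have "rk (w @ [a]) (Suc (length w)) = Suc (length (erase z w))"
      unfolding rk_def eq card_remaining_positions using True assms by simp
    then show ?thesis using True assms IH by (simp add: positions_snoc)
  qed
  then show ?case by (simp add: rk_def[abs_def])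
qed simp

lemma word_partition_minus:
  assumes "z \<in> set w"
  shows "word_partition w - {positions w z} = positions w ` (set w - {z})"
  unfolding word_partition_positions
  using positions_eq_iff[of _ w z] assms by auto

text \<open>Turns condition (3) into the deletion of a letter, so that the recursion can be followed
  on words.\<close>

lemma relabel_word_partition:
  assumes "z \<in> set w"
  shows "relabel ({1..length w} - positions w z) (word_partition w - {positions w z})
    = word_partition (erase z w)"
proof -
  have "relabel ({1..length w} - positions w z) (word_partition w - {positions w z})
    = (\<lambda>c. (\<lambda>x. card {y \<in> {1..length w} - positions w z. y \<le> x}) ` positions w c) ` (set w - {z})"
    unfolding relabel_def word_partition_minus[OF assms] image_image ..
  also have "\<dots> = positions (erase z w) ` (set w - {z})"
    by (intro image_cong refl relabel_positions) auto
  also have "\<dots> = word_partition (erase z w)"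
    unfolding word_partition_positions by (intro image_cong) auto
  finally show ?thesis .
qed

lemma Union_word_partition: "\<Union>(word_partition w) = {1..length w}"
  unfolding word_partition_positions by (rule positions_Un)

lemma partition_on_word_partition: "partition_on {1..length w} (word_partition w)"
proof (rule partition_onI)
  fix p p' assume "p \<in> word_partition w" "p' \<in> word_partition w" "p \<noteq> p'"
  then obtain c d where "p = positions w c" "p' = positions w d" "c \<noteq> d"
    unfolding word_partition_positions by blast
  then show "disjnt p p'" using positions_disjoint by (simp add: disjnt_def)
next
  show "{} \<notin> word_partition w"
    unfolding word_partition_positions using positions_empty_iff[of w] by force
qed (rule Union_word_partition)

lemma length_eq_of_word_partition:
  assumes "\<Union>(word_partition w) = {1..n}"
  shows "length w = n"
  using assms unfolding Union_word_partition by (metis card_atLeastAtMost diff_Suc_1)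

text \<open>The word is left general in the rule induction, so that the hypothesis for the
  relabelled partition applies to \<open>erase z w\<close>. A single block is the insertion of one
  letter into the empty word.\<close>

lemma tree_word_of_special_symmetric:
  assumes "special_symmetric k (word_partition w)" and "r \<notin> set w"
  shows "tree_word r w"
  using assms
proof (induction k "word_partition w" arbitrary: w rule: special_symmetric.induct)
  case (one_block k)
  have len: "length w = 2 * k"
    by (rule length_eq_of_word_partition) (simp flip: one_block.hyps(2))
  then obtain z where z: "z \<in> set w" using one_block.hyps(1) by (cases w) auto
  have "c = z" if "c \<in> set w" for c
    using one_block.hyps(2) z that positions_eq_iff[of c w z]
    unfolding word_partition_positions by (metis imageI singletonD)
  then have all: "set w \<subseteq> {z}" by auto
  have er: "erase z w = []" using all by (auto simp: filter_empty_conv)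
  have "count_list w z = 2 * k" using length_erase[of z w] er len by simp
  moreover have "paired z w"
    unfolding paired_def using all by auto
  moreover have "count_list p c = 0" if "w = p @ q" "c \<noteq> z" for p q c
    using that all by (auto simp: count_list_0_iff)
  ultimately have "balanced_letter z w"
    unfolding balanced_letter_def by (metis dvd_triv_left)
  then show ?case
    using tree_word_insert er tree_word_Nil one_block.prems z by metis
next
  case (last_block k V Is)
  have len: "length w = 2 * k"
    by (rule length_eq_of_word_partition) (use last_block.hyps(2) in \<open>simp add: partition_on_def\<close>)
  obtain z where z: "z \<in> set w" and V: "V = positions w z"
    using last_block.hyps(3) unfolding word_partition_positions by blast
  have "balanced_letter z w"
  proof (rule balanced_letter_of_intervals)
    show "positions w z = \<Union>(set Is)" using V last_block.hyps(6) by simp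
    fix c j assume "c \<in> set w" "c \<noteq> z" and j: "Suc j < length Is"
    then have "positions w c \<in> word_partition w - {V}"
      unfolding V word_partition_minus[OF z] by blast
    then show "even (card (positions w c \<inter> ({Min (Is ! j)..Max (Is ! Suc j)} - (Is ! j \<union> Is ! Suc j))))"
      using last_block.hyps(7) j by blast
  qed (rule last_block.hyps(5))
  moreover have "tree_word r (erase z w)"
    using last_block.hyps(8)
  proof
    assume "word_partition w - {V} = {}"
    then have "set w \<subseteq> {z}" unfolding V word_partition_minus[OF z] by blast
    then have "erase z w = []" by (auto simp: filter_empty_conv)
    then show ?thesis by (simp add: tree_word_Nil)
  next
    assume "special_symmetric (k - card V div 2) (relabel ({1..2 * k} - V) (word_partition w - {V})) \<and>
      (\<forall>x. relabel ({1..2 * k} - V) (word_partition w - {V}) = word_partition x \<longrightarrow>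
          r \<notin> set x \<longrightarrow> tree_word r x)"
    then show ?thesis
      using relabel_word_partition[OF z] last_block.prems unfolding V len by auto
  qed
  ultimately show ?case
    using tree_word_insert last_block.prems z by metis
qed

text \<open>The letter whose first occurrence comes latest satisfies the assumption of
  \<open>tree_word_remove\<close> and is taken off as the last block. No partition is special
  symmetric for \<open>k = 0\<close>, so the recursion ends at words with a single letter.\<close>

lemma special_symmetric_of_tree_word:
  assumes "tree_word r w" and "w \<noteq> []" and "length w = 2 * k"
  shows "special_symmetric k (word_partition w)"
  using assms
proof (induction "length w" arbitrary: w k rule: less_induct)
  case less
  define M where "M = Max ((\<lambda>c. Min (positions w c)) ` set w)"
  have "M \<in> (\<lambda>c. Min (positions w c)) ` set w"
    unfolding M_def using less.prems(2) by (intro Max_in) auto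
  then obtain z where z: "z \<in> set w" "Min (positions w z) = M" by auto
  then have last: "Min (positions w c) \<le> Min (positions w z)" if "c \<in> set w" for c
    using that unfolding z(2) M_def by (intro Max_ge) auto
  have later: "set w \<subseteq> insert z (set p)" if w: "w = p @ z # q" and p: "z \<notin> set p" for p q
  proof
    fix c assume c: "c \<in> set w"
    have "Suc (length p) \<in> positions w z" unfolding w mem_positions_append ..
    then have "Min (positions w z) \<le> Suc (length p)" by simp
    then have le: "Min (positions w c) \<le> Suc (length p)" using last[OF c] by simp
    have "Min (positions w c) \<in> positions w c"
      using c positions_empty_iff[of w c] by (intro Min_in) auto
    then obtain u v where u: "w = u @ c # v" "Min (positions w c) = Suc (length u)"
      by (rule mem_positionsE)
    show "c \<in> insert z (set p)"
    proof (cases "length u = length p")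
      case True
      then show ?thesis using u(1) w by simp
    next
      case False
      then have "length u < length p" using le u(2) by simp
      moreover have "w ! length u = c" unfolding u(1) by simp
      ultimately have "p ! length u = c" unfolding w by (simp add: nth_append)
      then show ?thesis using \<open>length u < length p\<close> by auto
    qed
  qed
  have bal: "balanced_letter z w" and tw: "tree_word r (erase z w)"
    using tree_word_remove[OF less.prems(1) z(1)] later by blast+
  have ev: "even (count_list w z)" using bal unfolding balanced_letter_def by blast
  have pos: "0 < count_list w z" using z(1) by (metis count_list_0_iff gr0I)
  have len: "length (erase z w) + count_list w z = 2 * k" using length_erase[of z w] less.prems(3) by simp
  show ?case
  proof (cases "erase z w = []")
    case True
    then have "\<forall>x\<in>set w. x = z" unfolding filter_empty_conv by simp
    then have "set w = {z}" using z(1) by blast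
    then have "word_partition w = {{1..2 * k}}"
      using Union_word_partition[of w] less.prems(3) by (simp add: word_partition_positions)
    then show ?thesis using special_symmetric.one_block[of k] less.prems(2,3) by (cases k) auto
  next
    case False
    obtain Is where Is: "increasing_even_intervals Is" "positions w z = \<Union>(set Is)"
      "\<And>c j. c \<noteq> z \<Longrightarrow> Suc j < length Is \<Longrightarrow>
        even (card (positions w c \<inter> ({Min (Is ! j)..Max (Is ! Suc j)} - (Is ! j \<union> Is ! Suc j))))"
      using intervals_of_balanced_letter[OF bal] by blast
    have "length (erase z w) > 0" using False by simp
    then have k: "1 < k" and len': "length (erase z w) = 2 * (k - count_list w z div 2)"
      using len ev pos by presburger+
    have "special_symmetric (k - card (positions w z) div 2) (word_partition (erase z w))"
      unfolding card_positions using less.hyps[OF _ tw False len'] len pos less.prems(3) by simp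
    then have rest: "special_symmetric (k - card (positions w z) div 2)
        (relabel ({1..2 * k} - positions w z) (word_partition w - {positions w z}))"
      using relabel_word_partition[OF z(1)] less.prems(3) by simp
    show ?thesis
    proof (rule special_symmetric.last_block[OF k _ _ _ Is(1,2)])
      show "partition_on {1..2 * k} (word_partition w)"
        using partition_on_word_partition[of w] less.prems(3) by simp
      show "positions w z \<in> word_partition w" "\<forall>W\<in>word_partition w. Min W \<le> Min (positions w z)"
        using z(1) last unfolding word_partition_positions by auto
      show "\<forall>W\<in>word_partition w - {positions w z}. \<forall>j. Suc j < length Is \<longrightarrow>
         even (card (W \<inter> ({Min (Is ! j)..Max (Is ! Suc j)} - (Is ! j \<union> Is ! Suc j))))"
        unfolding word_partition_minus[OF z(1)] using Is(3) by auto
    qed (use rest in blast)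
  qed
qed

section \<open>Contour words of trees\<close>

text \<open>Splits off the first child with its subtree. Keeping the colour \<open>x\<close> of the
  root apart from the list of its children treats the subtree and the remaining siblings
  alike.\<close>

lemma forest_induct [case_names Nil Cons]:
  fixes P :: "'c \<Rightarrow> 'c ptree list \<Rightarrow> bool"
  assumes Nil: "\<And>x. P x []"
    and Cons: "\<And>x y us ts. P y us \<Longrightarrow> P x ts \<Longrightarrow> P x (Node y us # ts)"
  shows "P x ts"
proof (induction "size_list size ts" arbitrary: x ts rule: less_induct)
  case less
  show ?case
  proof (cases ts)
    case (Cons t ts')
    obtain y us where "t = Node y us" by (cases t)
    then show ?thesis using less[of us y] less[of ts' x] Cons by (auto intro: assms(2))
  qed (simp add: Nil)
qed

lemma contour_word_Cons:
  "contour_word (Node x (Node y us # ts)) = y # contour_word (Node y us) @ y # contour_word (Node x ts)"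
  by simp

text \<open>A child with its parent's colour would pop the parent where it should be pushed.\<close>

fun proper :: "'c ptree \<Rightarrow> bool" where
  "proper (Node c ts) \<longleftrightarrow> (\<forall>t\<in>set ts. root_colour t \<noteq> c \<and> proper t)"

fun spines :: "'c ptree \<Rightarrow> 'c list set" where
  "spines (Node c ts) = insert [c] (\<Union>t\<in>set ts. (\<lambda>s. s @ [c]) ` spines t)"

text \<open>The walk returns to \<open>x # s\<close> after each child and never touches what lies
  below \<open>x\<close>. Hence \<open>s\<close> can be arbitrary, and it becomes
  \<open>x # s\<close> in the subtree of a child.\<close>

lemma visited_contour_word:
  assumes "proper (Node x ts)"
  shows "run (x # s) (contour_word (Node x ts)) = x # s"
    and "visited (x # s) (contour_word (Node x ts)) = (\<lambda>p. p @ s) ` spines (Node x ts)"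
proof -
  have "proper (Node x ts) \<longrightarrow> (\<forall>s. run (x # s) (contour_word (Node x ts)) = x # s \<and>
    visited (x # s) (contour_word (Node x ts)) = (\<lambda>p. p @ s) ` spines (Node x ts))"
  proof (induction x ts rule: forest_induct)
    case (Nil x)
    then show ?case by simp
  next
    case (Cons x y us ts)
    show ?case
    proof (intro impI allI)
      fix s assume pr: "proper (Node x (Node y us # ts))"
      then have xy: "y \<noteq> x" and "proper (Node y us)" "proper (Node x ts)" by auto
      then have run: "\<And>s. run (y # s) (contour_word (Node y us)) = y # s"
          "\<And>s. run (x # s) (contour_word (Node x ts)) = x # s"
        and vis: "\<And>s. visited (y # s) (contour_word (Node y us)) = (\<lambda>p. p @ s) ` spines (Node y us)"
          "\<And>s. visited (x # s) (contour_word (Node x ts)) = (\<lambda>p. p @ s) ` spines (Node x ts)"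
        using Cons.IH by blast+
      \<comment> \<open>The stack on entering the subtree occurs again on leaving it and has to be
        absorbed.\<close>
      have mem: "y # x # s \<in> (\<lambda>p. p @ x # s) ` spines (Node y us)" by force
      have "visited (x # s) (contour_word (Node x (Node y us # ts))) =
        insert (x # s) ((\<lambda>p. p @ x # s) ` spines (Node y us) \<union> (\<lambda>p. p @ s) ` spines (Node x ts))"
        unfolding contour_word_Cons using xy mem
        by (simp add: visited_Cons visited_append vis run del: contour_word.simps spines.simps) blast
      also have "\<dots> = (\<lambda>p. p @ s) ` spines (Node x (Node y us # ts))"
        by (auto simp: image_Un image_image image_UN)
      finally have "visited (x # s) (contour_word (Node x (Node y us # ts))) =
        (\<lambda>p. p @ s) ` spines (Node x (Node y us # ts))" .
      moreover have "run (x # s) (contour_word (Node x (Node y us # ts))) = x # s"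
        unfolding contour_word_Cons using xy by (simp add: run del: contour_word.simps)
      ultimately show "run (x # s) (contour_word (Node x (Node y us # ts))) = x # s \<and>
        visited (x # s) (contour_word (Node x (Node y us # ts))) =
          (\<lambda>p. p @ s) ` spines (Node x (Node y us # ts))" by blast
    qed
  qed
  with assms show "run (x # s) (contour_word (Node x ts)) = x # s"
    "visited (x # s) (contour_word (Node x ts)) = (\<lambda>p. p @ s) ` spines (Node x ts)" by blast+
qed

text \<open>The final stack is lower than \<open>x # s\<close>, so this \<open>x\<close> is popped
  at some point. Up to there the letters form a contour word: each pushed \<open>y\<close> opens a
  child that ends when \<open>y\<close> is popped. The two recursive calls read this child and its
  later siblings.\<close>

lemma contour_word_parse:
  assumes "run (x # s) w = s'" and "length s' \<le> length s"
  shows "\<exists>ts v. w = contour_word (Node x ts) @ x # v \<and> proper (Node x ts) \<and> run s v = s'"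
  using assms
proof (induction "length w" arbitrary: w x s rule: less_induct)
  case less
  show ?case
  proof (cases w)
    case Nil
    then show ?thesis using less.prems by auto
  next
    case w: (Cons y w1)
    show ?thesis
    proof (cases "y = x")
      case True
      then have "w = contour_word (Node x []) @ x # w1 \<and> proper (Node x []) \<and> run s w1 = s'"
        using w less.prems by simp
      then show ?thesis by blast
    next
      case False
      then have "run (y # x # s) w1 = s'" using w less.prems(1) by simp
      then obtain us v1 where 1: "w1 = contour_word (Node y us) @ y # v1" "proper (Node y us)"
        "run (x # s) v1 = s'"
        using less.hyps[of w1 y "x # s"] w less.prems(2) by auto
      then obtain ts v where 2: "v1 = contour_word (Node x ts) @ x # v" "proper (Node x ts)" "run s v = s'"
        using less.hyps[of v1 x s] w less.prems(2) by auto
      have "w = contour_word (Node x (Node y us # ts)) @ x # v"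
        unfolding contour_word_Cons w 1(1) 2(1) by simp
      moreover have "proper (Node x (Node y us # ts))" using 1(2) 2(2) False by simp
      ultimately show ?thesis using 2(3) by blast
    qed
  qed
qed

text \<open>The trailing \<open>x\<close> marks the end of the forest: no child has its parent's
  colour, so the next letter tells whether another child begins. The remainders \<open>v\<close> and
  \<open>v'\<close> let the induction pass from a child to its siblings.\<close>

lemma contour_word_unique:
  assumes "contour_word (Node x ts) @ x # v = contour_word (Node x ts') @ x # v'"
    and "proper (Node x ts)" and "proper (Node x ts')"
  shows "ts = ts' \<and> v = v'"
  using assms
proof (induction x ts arbitrary: ts' v v' rule: forest_induct)
  case (Nil x)
  show ?case
  proof (cases ts')
    case (Cons t ts'')
    then show ?thesis using Nil by (cases t) auto
  qed (use Nil in simp)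
next
  case (Cons x y us ts)
  have xy: "y \<noteq> x" and pr: "proper (Node y us)" "proper (Node x ts)"
    using Cons.prems(2) by auto
  show ?case
  proof (cases ts')
    case Nil
    then show ?thesis using Cons.prems(1) xy by simp
  next
    case ts': (Cons t' ts'')
    obtain y' us' where t': "t' = Node y' us'" by (cases t')
    have eq: "y # contour_word (Node y us) @ y # contour_word (Node x ts) @ x # v
      = y' # contour_word (Node y' us') @ y' # contour_word (Node x ts'') @ x # v'"
      using Cons.prems(1) unfolding ts' t' contour_word_Cons append_Cons append_assoc .
    then have y': "y' = y" by simp
    have "us = us' \<and> contour_word (Node x ts) @ x # v = contour_word (Node x ts'') @ x # v'"
      using eq Cons.prems(3) pr(1) unfolding y' ts' t'
      by (intro Cons.IH(1)) (simp_all del: contour_word.simps)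
    moreover from this have "ts = ts'' \<and> v = v'"
      using Cons.prems(3) pr(2) unfolding ts' by (intro Cons.IH(2)) simp_all
    ultimately show ?thesis using ts' t' y' by simp
  qed
qed

lemma tree_of_tree_word:
  assumes "tree_word r w"
  obtains ts where "w = contour_word (Node r ts)" "proper (Node r ts)"
proof -
  have r: "r \<notin> set w" "run [r] w = [r]" using assms by (auto simp: tree_word_def)
  \<comment> \<open>One more \<open>r\<close> pops the bottom, which gives the lower final stack
    that parsing requires. Since \<open>w\<close> does not contain \<open>r\<close>, nothing can
    follow that pop.\<close>
  then have "run [r] (w @ [r]) = []" by simp
  then obtain ts v where ts: "w @ [r] = contour_word (Node r ts) @ r # v" "proper (Node r ts)"
    using contour_word_parse[of r "[]" "w @ [r]" "[]"] by auto
  have "v = []"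
  proof (cases v rule: rev_cases)
    case (snoc v' x)
    then have "w = contour_word (Node r ts) @ r # v'" using ts(1) by simp
    then have "r \<in> set w" by simp
    then show ?thesis using r(1) by simp
  qed
  then show thesis using ts that by (simp del: contour_word.simps proper.simps)
qed

definition spine_determined :: "'c ptree \<Rightarrow> bool" where
  "spine_determined t \<longleftrightarrow> (\<forall>p\<in>spines t. \<forall>q\<in>spines t. hd p = hd q \<longrightarrow> p = q)"

lemma tree_word_contour_word:
  assumes "proper (Node r ts)"
  shows "tree_word r (contour_word (Node r ts)) \<longleftrightarrow>
    r \<notin> set (contour_word (Node r ts)) \<and> spine_determined (Node r ts)"
  using visited_contour_word[OF assms, of "[]"]
  by (simp add: tree_word_def spine_determined_def del: contour_word.simps spines.simps)

lemma root_spine: "[root_colour t] \<in> spines t"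
  by (cases t) auto

lemma spine_nonempty: "p \<in> spines t \<Longrightarrow> p \<noteq> []"
  by (cases t) auto

text \<open>\<open>[c]\<close> and \<open>[c, c]\<close> would be two spines with the same head. The
  property passes to subtrees because their spines are only extended at the root end.\<close>

lemma spine_determined_proper: "spine_determined t \<Longrightarrow> proper t"
proof (induction t)
  case (Node c ts)
  have "root_colour t \<noteq> c \<and> proper t" if t: "t \<in> set ts" for t
  proof
    have sub: "p @ [c] \<in> spines (Node c ts)" if "p \<in> spines t" for p using that t by auto
    show "root_colour t \<noteq> c"
    proof
      assume "root_colour t = c"
      then have "[c, c] \<in> spines (Node c ts)" using sub[OF root_spine] by simp
      moreover have "[c] \<in> spines (Node c ts)" by simp
      ultimately show False using Node.prems unfolding spine_determined_def
        by (metis list.distinct(1) list.inject list.sel(1))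
    qed
    have "p = q" if pq: "p \<in> spines t" "q \<in> spines t" "hd p = hd q" for p q
    proof -
      have "hd (p @ [c]) = hd (q @ [c])" using pq spine_nonempty by (metis hd_append2)
      then have "p @ [c] = q @ [c]"
        using sub pq(1,2) Node.prems unfolding spine_determined_def by blast
      then show ?thesis by simp
    qed
    then show "proper t" using Node.IH[OF t] unfolding spine_determined_def by blast
  qed
  then show ?case by simp
qed

section \<open>Vertex addresses, paths to the root and distances\<close>

lemma Nil_vertices [simp]: "[] \<in> vertices t"
  by (simp add: vertices_def)

lemma Cons_vertices: "i # v \<in> vertices t \<longleftrightarrow> i < length (subtrees t) \<and> v \<in> vertices (subtrees t ! i)"
  by (simp add: vertices_def)

lemma colour_at_Nil [simp]: "colour_at t [] = root_colour t"
  by (simp add: colour_at_def)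

lemma colour_at_Cons: "i < length (subtrees t) \<Longrightarrow> colour_at t (i # v) = colour_at (subtrees t ! i) v"
  by (simp add: colour_at_def)

lemma vertices_butlast: "v @ [i] \<in> vertices t \<Longrightarrow> v \<in> vertices t"
  by (induction v arbitrary: t) (auto simp: Cons_vertices)

fun spine_at :: "'c ptree \<Rightarrow> nat list \<Rightarrow> 'c list" where
  "spine_at t [] = [root_colour t]"
| "spine_at t (i # v) = spine_at (subtrees t ! i) v @ [root_colour t]"

lemma spine_at_snoc:
  "v @ [i] \<in> vertices t \<Longrightarrow> spine_at t (v @ [i]) = colour_at t (v @ [i]) # spine_at t v"
  by (induction v arbitrary: t) (auto simp: Cons_vertices colour_at_Cons)

lemma length_spine_at: "length (spine_at t v) = Suc (length v)"
  by (induction v arbitrary: t) auto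

lemma hd_spine_at: "v \<in> vertices t \<Longrightarrow> hd (spine_at t v) = colour_at t v"
proof (induction v rule: rev_induct)
  case (snoc i v)
  then show ?case by (simp add: spine_at_snoc)
qed simp

lemma spines_spine_at: "spines t = spine_at t ` vertices t"
proof (induction t)
  case (Node c ts)
  show ?case
  proof (intro equalityI subsetI)
    fix p assume "p \<in> spines (Node c ts)"
    then consider "p = [c]" | i q where "i < length ts" "q \<in> spines (ts ! i)" "p = q @ [c]"
      by (auto simp: in_set_conv_nth)
    then show "p \<in> spine_at (Node c ts) ` vertices (Node c ts)"
    proof cases
      case 1
      then show ?thesis by (intro image_eqI[of _ _ "[]"]) auto
    next
      case 2
      then obtain v where "v \<in> vertices (ts ! i)" "q = spine_at (ts ! i) v"
        using Node.IH[of "ts ! i"] by auto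
      then show ?thesis using 2 by (intro image_eqI[of _ _ "i # v"]) (auto simp: Cons_vertices)
    qed
  next
    fix p assume "p \<in> spine_at (Node c ts) ` vertices (Node c ts)"
    then obtain v where v: "v \<in> vertices (Node c ts)" "p = spine_at (Node c ts) v" by auto
    show "p \<in> spines (Node c ts)"
    proof (cases v)
      case Nil
      then show ?thesis using v by simp
    next
      case (Cons i u)
      then have "i < length ts" "u \<in> vertices (ts ! i)" using v by (auto simp: Cons_vertices)
      moreover from this have "spine_at (ts ! i) u \<in> spines (ts ! i)" using Node.IH[of "ts ! i"] by simp
      ultimately show ?thesis using v Cons by (auto intro!: bexI[of _ "ts ! i"])
    qed
  qed
qed

lemma spine_determined_iff:
  "spine_determined t \<longleftrightarrow> (\<forall>u\<in>vertices t. \<forall>v\<in>vertices t.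
     colour_at t u = colour_at t v \<longrightarrow> spine_at t u = spine_at t v)"
  by (auto simp: spine_determined_def spines_spine_at hd_spine_at)

text \<open>Iterating (b), two vertices of one colour have the same colours all the way up. Both
  paths end at the same moment, because the colour 0 of the root belongs to no other vertex.\<close>

lemma same_colour_parents_iff:
  assumes root: "\<forall>v\<in>vertices t. colour_at t v = 0 \<longleftrightarrow> v = []"
  shows "same_colour_parents t \<longleftrightarrow> spine_determined t"
proof
  assume "spine_determined t"
  then have eq: "spine_at t u = spine_at t v"
    if "u \<in> vertices t" "v \<in> vertices t" "colour_at t u = colour_at t v" for u v
    using that unfolding spine_determined_iff by blast
  show "same_colour_parents t"
    unfolding same_colour_parents_def parent_def
  proof (intro ballI impI)
    fix u v assume uv: "u \<in> vertices t - {[]}" "v \<in> vertices t - {[]}" "colour_at t u = colour_at t v"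
    obtain u' i v' j where u': "u = u' @ [i]" and v': "v = v' @ [j]"
      using uv(1,2) by (metis Diff_iff rev_exhaust singletonI)
    have "spine_at t u' = spine_at t v'"
      using eq[of u v] uv unfolding u' v' by (auto simp: spine_at_snoc)
    moreover have "u' \<in> vertices t" "v' \<in> vertices t" using uv vertices_butlast unfolding u' v' by auto
    ultimately show "colour_at t (butlast u) = colour_at t (butlast v)"
      using hd_spine_at unfolding u' v' by (metis butlast_snoc)
  qed
next
  assume par: "same_colour_parents t"
  have "spine_at t u = spine_at t v"
    if "u \<in> vertices t" "v \<in> vertices t" "colour_at t u = colour_at t v" for u v
    using that
  proof (induction u arbitrary: v rule: rev_induct)
    case Nil
    then have "v = []" using root by (metis Nil_vertices)
    then show ?case by simp
  next
    case (snoc i u)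
    then have "v \<noteq> []" using root by (metis snoc_eq_iff_butlast)
    then obtain v' j where v: "v = v' @ [j]" by (metis rev_exhaust)
    have uv: "u \<in> vertices t" "v' \<in> vertices t" using snoc.prems vertices_butlast unfolding v by auto
    have "colour_at t u = colour_at t v'"
      using par snoc.prems unfolding same_colour_parents_def parent_def v
      by (metis Diff_iff butlast_snoc singletonD snoc_eq_iff_butlast)
    then show ?case using snoc.IH[OF uv] snoc.prems unfolding v by (simp add: spine_at_snoc)
  qed
  then show "spine_determined t" unfolding spine_determined_iff by blast
qed

lemma length_le_relpow_adjacency:
  "([], v) \<in> adjacency t ^^ n \<Longrightarrow> length v \<le> n"
proof (induction n arbitrary: v)
  case (Suc n)
  then obtain u where "([], u) \<in> adjacency t ^^ n" "(u, v) \<in> adjacency t" by auto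
  then have "length u \<le> n" "length v \<le> Suc (length u)"
    using Suc.IH by (auto simp: adjacency_def parent_def)
  then show ?case by simp
qed simp

lemma relpow_adjacency_length:
  "v \<in> vertices t \<Longrightarrow> ([], v) \<in> adjacency t ^^ length v"
proof (induction v rule: rev_induct)
  case (snoc i v)
  then have "([], v) \<in> adjacency t ^^ length v" using vertices_butlast by blast
  moreover have "(v, v @ [i]) \<in> adjacency t"
    using snoc.prems vertices_butlast[OF snoc.prems] by (simp add: adjacency_def parent_def)
  ultimately show ?case by auto
qed simp

text \<open>An edge changes the length of an address by at most one, and the walk through the
  prefixes of \<open>v\<close> attains this bound.\<close>

lemma graph_dist_root: "v \<in> vertices t \<Longrightarrow> graph_dist t [] v = length v"
  unfolding graph_dist_def
  by (intro Least_equality relpow_adjacency_length length_le_relpow_adjacency)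

lemma same_colour_dist_if: "spine_determined t \<Longrightarrow> same_colour_dist t"
  unfolding spine_determined_iff same_colour_dist_def
  using length_spine_at graph_dist_root by (metis nat.inject)

section \<open>Counting vertices and letters by colour\<close>

lemma finite_vertices: "finite (vertices t)"
proof (induction t)
  case (Node c ts)
  have "vertices (Node c ts) \<subseteq> insert [] (\<Union>i<length ts. (#) i ` vertices (ts ! i))"
  proof
    fix v assume "v \<in> vertices (Node c ts)"
    then show "v \<in> insert [] (\<Union>i<length ts. (#) i ` vertices (ts ! i))"
      by (cases v) (auto simp: Cons_vertices)
  qed
  moreover have "finite (insert [] (\<Union>i<length ts. (#) i ` vertices (ts ! i)))"
    using Node.IH by simp
  ultimately show ?case by (rule finite_subset)
qed

text \<open>A predicate on colours lets one induction yield both the number of all vertices and the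
  number of each colour.\<close>

lemma card_vertices_filter:
  "card {v \<in> vertices t. P (colour_at t v)} = length (filter P (preorder t))"
proof (induction t)
  case (Node c ts)
  define S where "S i = (#) i ` {v \<in> vertices (ts ! i). P (colour_at (ts ! i) v)}" for i
  have card_S: "card (S i) = length (filter P (preorder (ts ! i)))" if "i < length ts" for i
    unfolding S_def using that Node.IH[of "ts ! i"] by (subst card_image) auto
  have fin: "finite (S i)" for i
    unfolding S_def by (rule finite_imageI, rule finite_subset[OF _ finite_vertices[of "ts ! i"]]) auto
  have S_iff: "i # u \<in> S j \<longleftrightarrow> i = j \<and> u \<in> vertices (ts ! j) \<and> P (colour_at (ts ! j) u)"
    "[] \<notin> S j" for i u j
    by (auto simp: S_def)
  have eq: "{v \<in> vertices (Node c ts). P (colour_at (Node c ts) v)}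
    = (if P c then {[]} else {}) \<union> (\<Union>i<length ts. S i)"
  proof (intro set_eqI)
    fix v show "v \<in> {v \<in> vertices (Node c ts). P (colour_at (Node c ts) v)} \<longleftrightarrow>
        v \<in> (if P c then {[]} else {}) \<union> (\<Union>i<length ts. S i)"
      by (cases v) (auto simp: S_iff Cons_vertices colour_at_Cons)
  qed
  have "card (\<Union>i<length ts. S i) = (\<Sum>i<length ts. card (S i))"
    by (rule card_UN_disjoint) (auto simp: fin, auto simp: S_def)
  also have "\<dots> = (\<Sum>i<length ts. length (filter P (preorder (ts ! i))))"
    using card_S by simp
  also have "\<dots> = length (filter P (concat (map preorder ts)))"
    by (simp add: filter_concat length_concat sum_list_sum_nth atLeast0LessThan)
  finally have "card (\<Union>i<length ts. S i) = length (filter P (concat (map preorder ts)))" .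
  moreover have "[] \<notin> (\<Union>i<length ts. S i)" by (auto simp: S_def)
  moreover have "finite (\<Union>i<length ts. S i)" using fin by simp
  ultimately show ?case unfolding eq by simp
qed

lemma card_vertices: "card (vertices t) = length (preorder t)"
  using card_vertices_filter[of t "\<lambda>_. True"] by simp

lemma count_list_filter: "count_list xs c = length (filter (\<lambda>x. x = c) xs)"
  by (induction xs) auto

lemma card_vertices_colour: "card {v \<in> vertices t. colour_at t v = c} = count_list (preorder t) c"
  using card_vertices_filter[of t "\<lambda>x. x = c"] by (simp add: count_list_filter)

lemma colours_preorder: "colour_at t ` vertices t = set (preorder t)"
proof (rule set_eqI)
  fix c
  have "c \<in> colour_at t ` vertices t \<longleftrightarrow> {v \<in> vertices t. colour_at t v = c} \<noteq> {}" by auto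
  also have "\<dots> \<longleftrightarrow> count_list (preorder t) c \<noteq> 0"
  proof -
    have "finite {v \<in> vertices t. colour_at t v = c}"
      by (rule finite_subset[OF _ finite_vertices[of t]]) auto
    then show ?thesis unfolding card_vertices_colour[symmetric] card_eq_0_iff by metis
  qed
  finally show "c \<in> colour_at t ` vertices t \<longleftrightarrow> c \<in> set (preorder t)" by (simp add: count_list_0_iff)
qed

lemma inj_on_colours: "inj_on (colour_at t) (vertices t) \<longleftrightarrow> distinct (preorder t)"
  using inj_on_iff_eq_card[OF finite_vertices, of "colour_at t" t]
  unfolding colours_preorder card_vertices by (metis card_distinct distinct_card)

text \<open>Each vertex below the root is written once on the way down and once on the way up; the
  root is never written.\<close>

lemma count_contour_word:
  "count_list (contour_word (Node x ts)) c = 2 * count_list (concat (map preorder ts)) c"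
proof (induction x ts rule: forest_induct)
  case (Cons x y us ts)
  show ?case unfolding contour_word_Cons count_list.simps count_list_append Cons.IH by simp
qed simp

lemma length_contour_word: "length (contour_word (Node x ts)) = 2 * length (concat (map preorder ts))"
proof (induction x ts rule: forest_induct)
  case (Cons x y us ts)
  then show ?case unfolding contour_word_Cons by (simp del: contour_word.simps)
qed simp

lemma set_contour_word: "set (contour_word (Node x ts)) = set (concat (map preorder ts))"
proof (rule set_eqI)
  fix c show "c \<in> set (contour_word (Node x ts)) \<longleftrightarrow> c \<in> set (concat (map preorder ts))"
    using count_contour_word[of x ts c] count_list_0_iff[of "contour_word (Node x ts)" c]
      count_list_0_iff[of "concat (map preorder ts)" c] by (metis mult_eq_0_iff zero_neq_numeral)
qed

section \<open>Order of first appearance\<close>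

lemma order_of_appearance_Nil [simp]: "order_of_appearance [] = []"
  by (simp add: order_of_appearance_def)

lemma order_of_appearance_snoc:
  "order_of_appearance (xs @ [x]) = (if x \<in> set xs then order_of_appearance xs else order_of_appearance xs @ [x])"
  by (simp add: order_of_appearance_def)

lemma set_order_of_appearance [simp]: "set (order_of_appearance xs) = set xs"
  by (simp add: order_of_appearance_def)

lemma distinct_order_of_appearance: "distinct (order_of_appearance xs)"
  by (simp add: order_of_appearance_def)

lemma length_order_of_appearance: "length (order_of_appearance xs) = card (set xs)"
  using distinct_card[OF distinct_order_of_appearance, of xs] by simp

lemma order_of_appearance_distinct: "distinct xs \<Longrightarrow> order_of_appearance xs = xs"
  by (simp add: order_of_appearance_def distinct_remdups_id)

lemma order_of_appearance_append:
  "order_of_appearance (xs @ ys) = order_of_appearance xs @ filter (\<lambda>y. y \<notin> set xs) (order_of_appearance ys)"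
proof (induction ys rule: rev_induct)
  case (snoc y ys)
  then show ?case by (simp add: order_of_appearance_snoc flip: append_assoc)
qed simp

lemma order_of_appearance_Cons:
  "order_of_appearance (x # xs) = x # erase x (order_of_appearance xs)"
  using order_of_appearance_append[of "[x]" xs] by (simp add: order_of_appearance_def)

text \<open>A colour can be new only on the way down, and the letters written on the way down are
  the preorder sequence without the root.\<close>

lemma order_of_appearance_contour_word:
  "order_of_appearance (contour_word (Node x ts)) = order_of_appearance (concat (map preorder ts))"
proof (induction x ts rule: forest_induct)
  case (Cons x y us ts)
  show ?case unfolding contour_word_Cons
    by (simp add: order_of_appearance_Cons order_of_appearance_append Cons.IH set_contour_word
        conj_commute del: contour_word.simps)
qed simp

section \<open>Catalan numbers\<close>

definition catalan :: "nat \<Rightarrow> real" where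
  "catalan n = real ((2 * n) choose n) / (real n + 1)"

lemma catalan_0 [simp]: "catalan 0 = 1"
  by (simp add: catalan_def)

lemma catalan_step: "(real n + 2) * catalan (Suc n) = 2 * (2 * real n + 1) * catalan n"
proof -
  have 1: "Suc n * (Suc (Suc (2 * n)) choose Suc n) = Suc (Suc (2 * n)) * (Suc (2 * n) choose n)"
    by (rule Suc_times_binomial)
  have 2: "Suc n * (Suc (2 * n) choose Suc n) = Suc (2 * n) * (2 * n choose n)"
    by (rule Suc_times_binomial)
  \<comment> \<open>Symmetry of row \<open>2 * n + 1\<close> links the two absorption
    identities.\<close>
  have "Suc (2 * n) choose n = Suc (2 * n) choose Suc n"
    using binomial_symmetric[of n "Suc (2 * n)"] by simp
  with 1 2 have "Suc n * (Suc n * (Suc (Suc (2 * n)) choose Suc n))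
      = Suc (Suc (2 * n)) * (Suc (2 * n) * (2 * n choose n))"
    by (metis mult.left_commute)
  then have "Suc n * (Suc n * (Suc (Suc (2 * n)) choose Suc n))
      = Suc n * (2 * (Suc (2 * n) * (2 * n choose n)))"
    by (metis mult.assoc mult.commute mult_Suc_right mult_2_right add_2_eq_Suc)
  then have "Suc n * (Suc (Suc (2 * n)) choose Suc n) = 2 * (Suc (2 * n) * (2 * n choose n))"
    by (metis mult_cancel1 Suc_neq_Zero)
  then have "real (Suc n * (Suc (Suc (2 * n)) choose Suc n)) = real (2 * (Suc (2 * n) * (2 * n choose n)))"
    by (rule arg_cong)
  then have "(real n + 1) * real (2 * Suc n choose Suc n) = 2 * (2 * real n + 1) * real (2 * n choose n)"
    by (simp only: of_nat_mult mult_Suc_right add_2_eq_Suc) (simp add: algebra_simps)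
  then have "real (2 * Suc n choose Suc n) = 2 * (2 * real n + 1) * (real (2 * n choose n) / (real n + 1))"
    by (simp add: field_simps)
  moreover have "(real n + 2) * catalan (Suc n) = real (2 * Suc n choose Suc n)"
    unfolding catalan_def by (simp only: of_nat_Suc) (simp add: add.commute)
  ultimately show ?thesis by (simp add: catalan_def)
qed

text \<open>The left-hand side is the coefficient of \<open>x^(n+1)\<close> in \<open>sqrt (1 - 4x)\<close>, whose square is linear; this
  yields the convolution identity below.\<close>

lemma gchoose_half_catalan: "((1/2) gchoose (Suc n)) * (-4) ^ Suc n = - 2 * catalan n"
proof (induction n)
  case (Suc n)
  define a b :: real where "a = (1/2) gchoose (Suc n)" and "b = (1/2) gchoose (Suc (Suc n))"
  define q :: real where "q = (-4) ^ Suc n"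
  \<comment> \<open>The resulting ratio of successive coefficients, multiplied by -4, is the ratio
    in \<open>catalan_step\<close>.\<close>
  have "1/2 * a = real (Suc n) * a + real (Suc (Suc n)) * b"
    unfolding a_def b_def by (rule gbinomial_mult_1)
  then have ab: "(real n + 2) * b = - (real n + 1/2) * a" by (simp add: algebra_simps)
  have "(real n + 2) * (b * (-4 * q)) = ((real n + 2) * b) * (-4 * q)" by simp
  also have "\<dots> = 2 * (2 * real n + 1) * (a * q)" unfolding ab by (simp add: algebra_simps)
  also have "\<dots> = (real n + 2) * (- 2 * catalan (Suc n))"
    using Suc catalan_step[of n] by (simp add: a_def q_def algebra_simps)
  finally have "b * (-4 * q) = - 2 * catalan (Suc n)" by (simp add: add_nonneg_pos)
  then show ?case by (simp add: b_def q_def)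
qed simp

lemma catalan_Suc: "catalan (Suc n) = (\<Sum>i\<le>n. catalan i * catalan (n - i))"
proof -
  define h :: "nat \<Rightarrow> real" where "h i = ((1/2) gchoose i) * (-4) ^ i" for i
  have h0: "h 0 = 1" and hS: "h (Suc i) = - 2 * catalan i" for i
    unfolding h_def using gchoose_half_catalan[of i] by simp_all
  \<comment> \<open>The coefficient of \<open>x^N\<close> in \<open>1 - 4x\<close> vanishes for
    \<open>N \<ge> 2\<close>. In the square, the two outer terms give
    \<open>- 4 * catalan (Suc n)\<close> and the inner ones 4 times the convolution.\<close>
  define N where "N = Suc (Suc n)"
  have "(\<Sum>i\<le>N. h i * h (N - i)) = (\<Sum>i\<le>N. ((1/2) gchoose i) * ((1/2) gchoose (N - i)) * (-4) ^ N)"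
    by (intro sum.cong refl) (simp add: h_def flip: power_add)
  also have "\<dots> = ((1/2 + 1/2) gchoose N) * (-4) ^ N"
    unfolding gbinomial_Vandermonde[symmetric] sum_distrib_right atMost_atLeast0 ..
  also have "(1/2 + 1/2 :: real) gchoose N = of_nat (1 choose N)"
    by (simp add: binomial_gbinomial)
  also have "1 choose N = 0" by (simp add: N_def)
  finally have "0 = (\<Sum>i\<le>N. h i * h (N - i))" by simp
  also have "\<dots> = (\<Sum>i\<le>Suc n. h i * h (N - i)) + h N * h 0"
    unfolding N_def by (simp only: sum.atMost_Suc diff_self_eq_0)
  also have "(\<Sum>i\<le>Suc n. h i * h (N - i)) = h 0 * h N + (\<Sum>i\<le>n. h (Suc i) * h (Suc (n - i)))"
    unfolding sum.atMost_Suc_shift N_def by (simp add: Suc_diff_le)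
  also have "h 0 * h N + (\<Sum>i\<le>n. h (Suc i) * h (Suc (n - i))) + h N * h 0 = - 4 * catalan (Suc n) + 4 * (\<Sum>i\<le>n. catalan i * catalan (n - i))"
    unfolding h0 hS N_def sum_distrib_left by simp
  finally show ?thesis by linarith
qed

lemma preorder_nonempty: "preorder t \<noteq> []"
  by (cases t) simp

text \<open>With the preorder sequence prescribed, only the shape is free. The first letter is the
  root of the first tree, the next \<open>i\<close> letters are the rest of this tree, and the
  remaining letters make up the other trees; summing over \<open>i\<close> is the convolution in
  \<open>catalan_Suc\<close>.\<close>

lemma card_forests:
  "finite {ts. concat (map preorder ts) = xs} \<and>
   real (card {ts. concat (map preorder ts) = xs}) = catalan (length xs)"
proof (induction "length xs" arbitrary: xs rule: less_induct)
  case less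
  define F where "F xs = {ts. concat (map preorder ts) = xs}" for xs :: "'a list"
  show ?case
  proof (cases xs)
    case Nil
    have "{ts. concat (map preorder ts) = xs} = {[]}"
      using Nil by (auto simp: preorder_nonempty neq_Nil_conv)
    then show ?thesis using Nil by simp
  next
    case (Cons x ys)
    define n where "n = length ys"
    define G where "G i = (\<lambda>(us, ts). Node x us # ts) ` (F (take i ys) \<times> F (drop i ys))" for i
    have IH: "finite (F zs) \<and> real (card (F zs)) = catalan (length zs)" if "length zs \<le> n" for zs
      unfolding F_def using less[of zs] that Cons by (simp add: n_def)
    have eq: "F xs = (\<Union>i\<le>n. G i)"
    proof (intro equalityI subsetI)
      fix ts assume "ts \<in> F xs"
      then have ts: "concat (map preorder ts) = x # ys" by (simp add: F_def Cons)
      then obtain t ts' where t: "ts = t # ts'" by (cases ts) auto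
      obtain y us where us: "t = Node y us" by (cases t)
      define i where "i = length (concat (map preorder us))"
      have y: "y = x" and "concat (map preorder us) @ concat (map preorder ts') = ys"
        using ts t us by auto
      then have "(us, ts') \<in> F (take i ys) \<times> F (drop i ys)" and i: "i \<le> n"
        unfolding i_def n_def F_def by auto
      then have "Node x us # ts' \<in> G i" unfolding G_def by force
      then show "ts \<in> (\<Union>i\<le>n. G i)" using i unfolding t us y by blast
    next
      fix ts assume "ts \<in> (\<Union>i\<le>n. G i)"
      then show "ts \<in> F xs" by (auto simp: G_def F_def Cons)
    qed
    have fin: "finite (G i)" and card: "real (card (G i)) = catalan i * catalan (n - i)" if "i \<le> n" for i
    proof -
      have inj: "inj_on (\<lambda>(us, ts). Node x us # ts) (F (take i ys) \<times> F (drop i ys))"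
        by (auto simp: inj_on_def)
      have 1: "finite (F (take i ys)) \<and> real (card (F (take i ys))) = catalan i"
        using IH[of "take i ys"] that by (simp add: n_def)
      have 2: "finite (F (drop i ys)) \<and> real (card (F (drop i ys))) = catalan (n - i)"
        using IH[of "drop i ys"] by (simp add: n_def)
      show "finite (G i)" unfolding G_def using 1 2 by blast
      show "real (card (G i)) = catalan i * catalan (n - i)"
        unfolding G_def card_image[OF inj] card_cartesian_product of_nat_mult using 1 2 by simp
    qed
    \<comment> \<open>The index \<open>i\<close> is recovered as the number of proper descendants of
      the first root.\<close>
    have disj: "G i \<inter> G j = {}" if "i \<le> n" "j \<le> n" "i \<noteq> j" for i j
    proof -
      have len: "length (concat (map preorder us)) = i"
        if "Node x us # ts \<in> G i" "i \<le> n" for us ts i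
        using that by (auto simp: G_def F_def n_def)
      have False if "t \<in> G i" "t \<in> G j" for t
      proof -
        obtain us ts where "t = Node x us # ts" using \<open>t \<in> G i\<close> unfolding G_def by auto
        then show False using len that \<open>i \<le> n\<close> \<open>j \<le> n\<close> \<open>i \<noteq> j\<close> by metis
      qed
      then show ?thesis by blast
    qed
    have "card (\<Union>i\<le>n. G i) = (\<Sum>i\<le>n. card (G i))"
      by (rule card_UN_disjoint) (use fin disj in auto)
    then have "real (card (F xs)) = (\<Sum>i\<le>n. catalan i * catalan (n - i))"
      unfolding eq using card by simp
    moreover have "finite (F xs)" unfolding eq using fin by simp
    ultimately show ?thesis
      using catalan_Suc[of n] Cons unfolding F_def n_def by simp
  qed
qed

section \<open>The correspondence\<close>

text \<open>Numbering the letters from 1 keeps 0 free for the bottom of the stack, which becomes the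
  colour of the root.\<close>

lemma SS_words_iff:
  assumes "1 \<le> k"
  shows "w \<in> SS_words b k \<longleftrightarrow>
    length w = 2 * k \<and> order_of_appearance w = [1..<Suc b] \<and> tree_word 0 w"
proof -
  have card: "card (set w) = b" if "order_of_appearance w = [1..<Suc b]"
    using that length_order_of_appearance[of w] by (simp del: upt_Suc)
  have zero: "0 \<notin> set w" if "order_of_appearance w = [1..<Suc b]"
  proof -
    have "set w = set [1..<Suc b]" using set_order_of_appearance[of w] unfolding that by (rule sym)
    then show ?thesis by (simp del: upt_Suc)
  qed
  have "special_symmetric k (word_partition w) \<longleftrightarrow> tree_word 0 w"
    if "length w = 2 * k" "0 \<notin> set w"
    using that assms tree_word_of_special_symmetric special_symmetric_of_tree_word by fastforce
  then show ?thesis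
    unfolding SS_words_def using card zero by auto
qed

lemma colour_zero_iff:
  "(\<forall>v\<in>vertices (Node c ts). colour_at (Node c ts) v = 0 \<longleftrightarrow> v = []) \<longleftrightarrow>
    c = 0 \<and> 0 \<notin> set (concat (map preorder ts))"
  (is "?L \<longleftrightarrow> ?R")
proof -
  let ?t = "Node c ts"
  define Z where "Z = {v \<in> vertices ?t. colour_at ?t v = 0}"
  have card: "card Z = (if c = 0 then 1 else 0) + count_list (concat (map preorder ts)) 0"
    unfolding Z_def card_vertices_colour by simp
  have mem: "[] \<in> Z \<longleftrightarrow> c = 0" by (simp add: Z_def)
  have "?L \<longleftrightarrow> Z = {[]}" unfolding Z_def by auto
  also have "\<dots> \<longleftrightarrow> c = 0 \<and> card Z = 1"
    unfolding mem[symmetric] by (auto simp: card_1_singleton_iff)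
  also have "\<dots> \<longleftrightarrow> ?R"
    unfolding card by (auto simp del: set_concat simp: count_list_0_iff)
  finally show ?thesis .
qed

text \<open>Apart from the colour of the root, every condition can be read off from the contour
  word. The root accounts for the 0 that separates \<open>[0..<b + 1]\<close> from
  \<open>[1..<Suc b]\<close>.\<close>

lemma coloured_trees_iff:
  "Node c ts \<in> coloured_trees b k \<longleftrightarrow> c = 0 \<and> 0 \<notin> set (contour_word (Node c ts)) \<and>
    order_of_appearance (contour_word (Node c ts)) = [1..<Suc b] \<and>
    length (contour_word (Node c ts)) = 2 * k"
proof -
  let ?P = "concat (map preorder ts)"
  have card: "card (vertices (Node c ts)) = k + 1 \<longleftrightarrow> length ?P = k"
    by (simp add: card_vertices)
  have N: "card (colour_at (Node c ts) ` vertices (Node c ts)) = length (order_of_appearance (c # ?P))"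
    unfolding colours_preorder length_order_of_appearance by simp
  have oa: "order_of_appearance (0 # ?P) = 0 # order_of_appearance ?P" if "0 \<notin> set ?P"
  proof -
    have "erase 0 (order_of_appearance ?P) = order_of_appearance ?P"
      by (rule filter_True) (use that in \<open>metis set_order_of_appearance\<close>)
    then show ?thesis unfolding order_of_appearance_Cons by simp
  qed
  have upt: "[0..<b + 1] = 0 # [1..<Suc b]"
    by (simp add: upt_conv_Cons)
  have "Node c ts \<in> coloured_trees b k \<longleftrightarrow> (c = 0 \<and> 0 \<notin> set ?P) \<and> length ?P = k \<and>
    order_of_appearance (c # ?P) = [0..<b + 1]"
    unfolding coloured_trees_def coloured_tree_def mem_Collect_eq colour_zero_iff N card
    by (auto simp del: set_concat upt_Suc)
  also have "\<dots> \<longleftrightarrow> c = 0 \<and> 0 \<notin> set ?P \<and> order_of_appearance ?P = [1..<Suc b] \<and> length ?P = k"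
    unfolding upt using oa by auto
  finally show ?thesis
    unfolding set_contour_word order_of_appearance_contour_word length_contour_word by simp
qed

text \<open>\<open>proper\<close> follows from the left-hand side by
  \<open>spine_determined_proper\<close>. It is listed on the right because decoding a word produces
  a proper tree and is unique among these.\<close>

lemma valid_tree_iff:
  "Node c ts \<in> coloured_trees b k \<and> same_colour_parents (Node c ts) \<and> same_colour_dist (Node c ts) \<longleftrightarrow>
    c = 0 \<and> proper (Node c ts) \<and> order_of_appearance (contour_word (Node c ts)) = [1..<Suc b] \<and>
    length (contour_word (Node c ts)) = 2 * k \<and> tree_word 0 (contour_word (Node c ts))"
proof -
  have "same_colour_parents (Node c ts) \<and> same_colour_dist (Node c ts) \<longleftrightarrow>
      proper (Node c ts) \<and> spine_determined (Node c ts)"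
    if "c = 0" "0 \<notin> set (contour_word (Node c ts))"
  proof -
    have "\<forall>v\<in>vertices (Node c ts). colour_at (Node c ts) v = 0 \<longleftrightarrow> v = []"
      unfolding colour_zero_iff using that unfolding set_contour_word by blast
    from same_colour_parents_iff[OF this] show ?thesis
      using same_colour_dist_if spine_determined_proper by blast
  qed
  then show ?thesis
    unfolding coloured_trees_iff using tree_word_contour_word[of 0 ts]
    by (metis tree_word_def)
qed

lemma bij_contour_word:
  assumes "1 \<le> k"
  shows "bij_betw contour_word
    {t \<in> coloured_trees b k. same_colour_parents t \<and> same_colour_dist t} (SS_words b k)"
    (is "bij_betw _ ?A ?B")
proof -
  have A: "\<exists>ts. t = Node 0 ts \<and> proper t \<and> contour_word t \<in> ?B" if "t \<in> ?A" for t
    using that valid_tree_iff[of "root_colour t" "subtrees t" b k]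
    unfolding SS_words_iff[OF assms] by (metis (no_types, lifting) mem_Collect_eq ptree.collapse)
  have "inj_on contour_word ?A"
  proof (rule inj_onI)
    fix t t' assume "t \<in> ?A" "t' \<in> ?A" "contour_word t = contour_word t'"
    then show "t = t'" using A[of t] A[of t'] contour_word_unique[of 0 _ "[]" _ "[]"] by metis
  qed
  moreover have "contour_word ` ?A = ?B"
  proof (intro equalityI subsetI)
    fix w assume "w \<in> contour_word ` ?A"
    then show "w \<in> ?B" using A by blast
  next
    fix w assume w: "w \<in> ?B"
    then have "tree_word 0 w" unfolding SS_words_iff[OF assms] by blast
    then obtain ts where "w = contour_word (Node 0 ts)" "proper (Node 0 ts)" by (rule tree_of_tree_word)
    moreover from this have "Node 0 ts \<in> ?A"
      using valid_tree_iff[of 0 ts b k] w unfolding SS_words_iff[OF assms] by blast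
    ultimately show "w \<in> contour_word ` ?A" by blast
  qed
  ultimately show ?thesis unfolding bij_betw_def by blast
qed

lemma colour_multiplicities_iff:
  assumes "t \<in> coloured_trees b k"
  shows "colour_multiplicities b m t \<longleftrightarrow> (\<forall>i\<in>{1..b}. count_list (contour_word t) i = 2 * m i)"
proof -
  obtain c ts where t: "t = Node c ts" by (cases t)
  then have c: "c = 0" using assms coloured_trees_iff by blast
  have "card {v \<in> vertices t. colour_at t v = i} = count_list (concat (map preorder ts)) i" if "i \<in> {1..b}" for i
    using that unfolding card_vertices_colour t c by simp
  then show ?thesis
    unfolding colour_multiplicities_def t count_contour_word using c by (simp del: contour_word.simps)
qed

text \<open>If all colours differ, numbering them by first appearance makes the preorder sequence
  \<open>[0..<k + 1]\<close>, so only the shape is free. Without its root, such a tree is a forest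
  with preorder sequence \<open>[1..<Suc k]\<close>.\<close>

lemma card_rainbow_trees:
  "real (card {t. coloured_tree t \<and> card (vertices t) = k + 1 \<and> inj_on (colour_at t) (vertices t)})
    = catalan k"
proof -
  have "coloured_tree t \<and> card (vertices t) = k + 1 \<and> inj_on (colour_at t) (vertices t) \<longleftrightarrow>
      preorder t = [0..<k + 1]" (is "?L \<longleftrightarrow> ?R") for t
  proof
    assume ?L
    then have "distinct (preorder t)" "card (colour_at t ` vertices t) = k + 1"
      by (auto simp: inj_on_colours card_image)
    then show ?R using \<open>?L\<close> unfolding coloured_tree_def by (simp add: order_of_appearance_distinct)
  next
    assume R: ?R
    obtain c ts where t: "t = Node c ts" by (cases t)
    have dist: "distinct (preorder t)" unfolding R by simp
    then have inj: "inj_on (colour_at t) (vertices t)" by (simp add: inj_on_colours)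
    moreover have card: "card (vertices t) = k + 1" unfolding card_vertices R by simp
    moreover have "\<forall>v\<in>vertices t. colour_at t v = 0 \<longleftrightarrow> v = []"
    proof -
      have "c # concat (map preorder ts) = 0 # [1..<Suc k]"
        using R unfolding t by (simp add: upt_conv_Cons del: upt_Suc)
      then show ?thesis unfolding t colour_zero_iff by (simp del: upt_Suc set_concat)
    qed
    ultimately show ?L
      unfolding coloured_tree_def order_of_appearance_distinct[OF dist] using R by (simp add: card_image)
  qed
  then have "{t. coloured_tree t \<and> card (vertices t) = k + 1 \<and> inj_on (colour_at t) (vertices t)}
    = {t. preorder t = [0..<k + 1]}" by blast
  also have "\<dots> = Node 0 ` {ts. concat (map preorder ts) = [1..<Suc k]}"
  proof (intro set_eqI)
    fix t :: "nat ptree"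
    have "preorder (Node c ts) = [0..<k + 1] \<longleftrightarrow> c = 0 \<and> concat (map preorder ts) = [1..<Suc k]" for c ts
      by (simp add: upt_conv_Cons del: upt_Suc)
    then show "t \<in> {t. preorder t = [0..<k + 1]} \<longleftrightarrow>
        t \<in> Node 0 ` {ts. concat (map preorder ts) = [1..<Suc k]}"
      by (cases t) auto
  qed
  finally show ?thesis
    using card_forests[of "[1..<Suc k]"] by (simp add: card_image inj_on_def del: upt_Suc)
qed

theorem lemma5p1:
  fixes k b :: nat and m :: "nat \<Rightarrow> nat"
  assumes "1 \<le> k"
  shows
    "(\<forall>w\<in>SS_words b k. (\<forall>i\<in>{1..b}. count_list w i = 2 * m i) \<longrightarrow>
        (\<exists>t\<in>coloured_trees b k. contour_word t = w \<and>
           colour_multiplicities b m t \<and> same_colour_parents t \<and> same_colour_dist t)) \<and>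
     bij_betw contour_word
       {t \<in> coloured_trees b k. same_colour_parents t \<and> same_colour_dist t}
       (SS_words b k) \<and>
     bij_betw contour_word
       {t \<in> coloured_trees b k. colour_multiplicities b m t \<and>
          same_colour_parents t \<and> same_colour_dist t}
       {w \<in> SS_words b k. \<forall>i\<in>{1..b}. count_list w i = 2 * m i} \<and>
     real (card {t. coloured_tree t \<and> card (vertices t) = k + 1 \<and>
                    inj_on (colour_at t) (vertices t)})
       = 1 / (real k + 1) * real ((2 * k) choose k)"
proof -
  let ?A = "{t \<in> coloured_trees b k. same_colour_parents t \<and> same_colour_dist t}"
  let ?A' = "{t \<in> coloured_trees b k. colour_multiplicities b m t \<and>
          same_colour_parents t \<and> same_colour_dist t}"
  let ?B' = "{w \<in> SS_words b k. \<forall>i\<in>{1..b}. count_list w i = 2 * m i}"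
  note bij = bij_contour_word[OF assms, of b]
  \<comment> \<open>Multiplicities are visible in the word, so the bijection for given
    multiplicities is a restriction of the general one.\<close>
  have "contour_word ` ?A' = ?B'"
    unfolding bij_betw_imp_surj_on[OF bij, symmetric] using colour_multiplicities_iff by blast
  then have bij': "bij_betw contour_word ?A' ?B'"
    using bij_betw_subset[OF bij, of ?A'] by blast
  moreover have "\<exists>t\<in>coloured_trees b k. contour_word t = w \<and>
           colour_multiplicities b m t \<and> same_colour_parents t \<and> same_colour_dist t"
    if "w \<in> SS_words b k" "\<forall>i\<in>{1..b}. count_list w i = 2 * m i" for w
  proof -
    have "w \<in> contour_word ` ?A'" using bij_betw_imp_surj_on[OF bij'] that by blast
    then show ?thesis by blast
  qed
  ultimately show ?thesis
    using bij card_rainbow_trees[of k] by (simp add: catalan_def)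
qed

end
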